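(* Let $N\ge2$, let $\Omega\subset\mathbb{R}^N$ be radially symmetric (a ball centered at the origin or a spherical shell), let $H=H(|x|,u,v)$ be continuous with respect to $x$ and $C^2$ with respect to $(u,v)\in\mathbb{R}^2$, and suppose that for almost every $x\in\Omega$ $$\frac{H_u(|x|,u,v)}{u}>0,\qquad\frac{H_v(|x|,u,v)}{v}>0\qquad\text{for every }u,v\neq0.$$ Let $(u,v)$ be a classical radial solution to $$-\Delta u=H_v(|x|,u,v),\quad -\Delta v=H_u(|x|,u,v)\ \text{ in }\Omega,\qquad u=v=0\ \text{ on }\partial\Omega.$$ Then the following holds. A. If one between $u$ and $v$ is strictly positive (or negative) in $\Omega$, then both $u$ and $v$ are strictly positive (or negative) in $\Omega$, and each of them has only one critical point (as a function of $r=|x|$), which coincides with the origin if $\Omega$ is a ball. B. If one between $u$ and $v$ has exactly $m\ge2$ nodal zones and $m-1$ internal zeros, then both $u$ and $v$ have exactly $m$ nodal zones and $m-1$ internal zeros, they have the same sign in their first nodal zone (and therefore in the following ones), and each has exactly one critical point inside each nodal zone. Moreover the nodal zones are intertwined, meaning that, for each $i$, the $i$-th nodal zones of $u$ and $v$ have a non-empty intersection, which contains both the critical point of $u$ and the critical point of $v$ lying in their respective $i$-th nodal zones.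
   Context: A radially symmetric domain is $\{|x|<R\}$ or $\{\delta<|x|<R\}$ with $0<\delta<R$. Radial functions are regarded as functions of $r=|x|$; zeros, critical points and nodal zones are understood in the variable $r$. Internal zeros are zeros at points $r$ with $x\in\Omega$, $|x|=r$ (i.e. not on $\partial\Omega$). Nodal zones are the connected components (intervals in $r$) of the set in $\Omega$ where the function does not vanish, ordered by increasing $r$ (for a ball the first nodal zone contains the origin $r=0$). *)

theory Defs
  imports "HOL-Analysis.Analysis"
begin

section \<open>Derivatives, classes \<open>C\<^sup>2\<close>, Laplacian\<close>

definition partial_deriv :: "'a::euclidean_space \<Rightarrow> ('a \<Rightarrow> real) \<Rightarrow> 'a \<Rightarrow> real" where
  "partial_deriv b f x = frechet_derivative f (at x) b"

text \<open>To be used for open \<open>S\<close>. Continuity of \<open>f\<close> and of its first partial derivatives is implied by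
  their differentiability.\<close>
definition C2_on :: "'a::euclidean_space set \<Rightarrow> ('a \<Rightarrow> real) \<Rightarrow> bool" where
  "C2_on S f \<longleftrightarrow>
     (\<forall>x\<in>S. f differentiable (at x)) \<and>
     (\<forall>b\<in>Basis. \<forall>x\<in>S. partial_deriv b f differentiable (at x)) \<and>
     (\<forall>b\<in>Basis. \<forall>c\<in>Basis. continuous_on S (partial_deriv c (partial_deriv b f)))"

definition laplacian :: "('a::euclidean_space \<Rightarrow> real) \<Rightarrow> 'a \<Rightarrow> real" where
  "laplacian f x = (\<Sum>b\<in>Basis. partial_deriv b (partial_deriv b f) x)"

section \<open>The Hamiltonian system\<close>

text \<open>A Hamiltonian takes a radius and a point of \<open>\<real>\<^sup>2\<close>: \<open>H(r,u,v)\<close> is \<open>H r (u, v)\<close>.\<close>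

definition H_u :: "(real \<Rightarrow> real \<times> real \<Rightarrow> real) \<Rightarrow> real \<Rightarrow> real \<Rightarrow> real \<Rightarrow> real" where
  "H_u H r s t = partial_deriv (1, 0) (H r) (s, t)"

definition H_v :: "(real \<Rightarrow> real \<times> real \<Rightarrow> real) \<Rightarrow> real \<Rightarrow> real \<Rightarrow> real \<Rightarrow> real" where
  "H_v H r s t = partial_deriv (0, 1) (H r) (s, t)"

definition classical_solution ::
  "'a::euclidean_space set \<Rightarrow> (real \<Rightarrow> real \<times> real \<Rightarrow> real) \<Rightarrow> ('a \<Rightarrow> real) \<Rightarrow> ('a \<Rightarrow> real) \<Rightarrow> bool" where
  "classical_solution \<Omega> H u v \<longleftrightarrow>
     C2_on \<Omega> u \<and> C2_on \<Omega> v \<and>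
     continuous_on (closure \<Omega>) u \<and> continuous_on (closure \<Omega>) v \<and>
     (\<forall>x\<in>\<Omega>. - laplacian u x = H_v H (norm x) (u x) (v x)) \<and>
     (\<forall>x\<in>\<Omega>. - laplacian v x = H_u H (norm x) (u x) (v x)) \<and>
     (\<forall>x\<in>frontier \<Omega>. u x = 0 \<and> v x = 0)"

section \<open>Radial domains and radial functions\<close>

definition centered_ball :: "'a::euclidean_space set \<Rightarrow> bool" where
  "centered_ball \<Omega> \<longleftrightarrow> (\<exists>R>0. \<Omega> = {x. norm x < R})"

definition spherical_shell :: "'a::euclidean_space set \<Rightarrow> bool" where
  "spherical_shell \<Omega> \<longleftrightarrow> (\<exists>\<delta> R. 0 < \<delta> \<and> \<delta> < R \<and> \<Omega> = {x. \<delta> < norm x \<and> norm x < R})"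

text \<open>\<open>U\<close> is \<open>u\<close> regarded as a function of \<open>r = \<bar>x\<bar>\<close>; only its values on \<open>norm ` closure \<Omega>\<close> matter.\<close>
definition radial_profile :: "'a::euclidean_space set \<Rightarrow> ('a \<Rightarrow> real) \<Rightarrow> (real \<Rightarrow> real) \<Rightarrow> bool" where
  "radial_profile \<Omega> u U \<longleftrightarrow> (\<forall>x\<in>closure \<Omega>. u x = U (norm x))"

text \<open>The derivative is relative to the interval of radii, so it is one-sided at the origin of a ball
  and on the boundary.\<close>
definition critical_radius :: "'a::euclidean_space set \<Rightarrow> (real \<Rightarrow> real) \<Rightarrow> real \<Rightarrow> bool" where
  "critical_radius \<Omega> U r \<longleftrightarrow>
     r \<in> norm ` closure \<Omega> \<and> (U has_real_derivative 0) (at r within norm ` closure \<Omega>)"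

definition internal_zeros :: "'a::euclidean_space set \<Rightarrow> (real \<Rightarrow> real) \<Rightarrow> real set" where
  "internal_zeros \<Omega> U = {r \<in> norm ` \<Omega>. U r = 0}"

definition nodal_zones :: "'a::euclidean_space set \<Rightarrow> (real \<Rightarrow> real) \<Rightarrow> real set set" where
  "nodal_zones \<Omega> U = components {r \<in> norm ` \<Omega>. U r \<noteq> 0}"

definition nodal_count :: "'a::euclidean_space set \<Rightarrow> (real \<Rightarrow> real) \<Rightarrow> nat \<Rightarrow> bool" where
  "nodal_count \<Omega> U m \<longleftrightarrow>
     finite (nodal_zones \<Omega> U) \<and> card (nodal_zones \<Omega> U) = m \<and>
     finite (internal_zeros \<Omega> U) \<and> card (internal_zeros \<Omega> U) = m - 1"

text \<open>\<open>Z 1, \<dots>, Z m\<close> lists the nodal zones by increasing \<open>r\<close>.\<close>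
definition ordered_nodal_zones ::
  "'a::euclidean_space set \<Rightarrow> (real \<Rightarrow> real) \<Rightarrow> nat \<Rightarrow> (nat \<Rightarrow> real set) \<Rightarrow> bool" where
  "ordered_nodal_zones \<Omega> U m Z \<longleftrightarrow>
     bij_betw Z {1..m} (nodal_zones \<Omega> U) \<and>
     (\<forall>i\<in>{1..m}. \<forall>j\<in>{1..m}. i < j \<longrightarrow> (\<forall>r\<in>Z i. \<forall>s\<in>Z j. r < s))"

text \<open>Only one critical point on the closed interval of radii, and it is not on the boundary.\<close>
definition single_critical_point :: "'a::euclidean_space set \<Rightarrow> (real \<Rightarrow> real) \<Rightarrow> bool" where
  "single_critical_point \<Omega> U \<longleftrightarrow>
     (\<exists>c \<in> norm ` \<Omega>. {r. critical_radius \<Omega> U r} = {c} \<and> (centered_ball \<Omega> \<longrightarrow> c = 0))"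

end

theory Submission
  imports Defs
begin

text \<open>In the variable \<open>r = \<bar>x\<bar>\<close> the system reads \<open>p' = - F\<close>, \<open>q' = - G\<close> for the fluxes
\<open>p = r\<^sup>k U'\<close>, \<open>q = r\<^sup>k V'\<close>, where \<open>k + 1\<close> is the dimension. The right-hand sides
enter through their signs: \<open>F\<close> weakly has the sign of \<open>V\<close>, \<open>G\<close> weakly has the sign of \<open>U\<close>, and on an
interval where neither \<open>U\<close> nor \<open>V\<close> vanishes neither \<open>F\<close> nor \<open>G\<close> vanishes identically. These
facts pass from almost every radius to intervals because the radii with the sign condition are dense
and the Laplacians are continuous.

The fluxes are monotone wherever the other function has a sign, and this couples the oscillations.
If \<open>U\<close> takes alternating signs at \<open>n\<close> radii, it has \<open>n\<close> critical points at which its signs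
alternate; to the right of each one, before \<open>U\<close> has returned to \<open>0\<close>, the flux \<open>p\<close> has moved away
from \<open>0\<close> in the direction that forces \<open>V\<close> to take the sign of \<open>U\<close>. So \<open>V\<close> takes the same
alternating signs (\<open>alternates_transfer\<close>). The critical point at the origin of a ball, or the
Dirichlet condition on the inner sphere of a shell, provides the first critical point.

Now let \<open>U\<close> have \<open>m\<close> nodal zones. Rolle's theorem gives one critical point in each zone. Between
two consecutive ones \<open>p\<close> returns to \<open>0\<close> without vanishing identically, so \<open>V\<close> takes both signs
there, and hence takes alternating signs at \<open>m\<close> radii (\<open>other_alternates\<close>). Transferring back, \<open>U\<close>
changes sign at each of its zeros. Moreover \<open>V\<close> has \<open>m\<close> critical points with alternating nonzero
values, and each zone of \<open>U\<close> contains exactly one of them because \<open>q\<close> is monotone there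
(\<open>other_critical_in_cells\<close>). This excludes intervals of zeros of \<open>V\<close>: such an interval, together
with a critical point of nonzero value in the same zone, would make \<open>V\<close> constant between them. So
\<open>V\<close> has finitely many zeros (\<open>other_zeros_finite\<close>), the previous arguments apply to \<open>V\<close> too, and
comparing the two counts shows that \<open>V\<close> also has \<open>m\<close> zones, with the same signs
(\<open>other_lists_zeros\<close>, \<open>common_signs\<close>).

Once the zeros of both functions are known to be finite in number, \<open>p\<close> is strictly monotone on the
closure of each zone of \<open>V\<close>, so each such closure contains at most one critical point of \<open>U\<close>. There
are \<open>m\<close> closed zones of \<open>V\<close> and at least \<open>m\<close> critical points of \<open>U\<close>, one in each zone of
\<open>U\<close>, so the \<open>i\<close>-th critical point of \<open>U\<close> lies in the interior of the \<open>i\<close>-th zone of both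
functions, and there are no others (\<open>interlaced_critical\<close>). The positive and negative cases are the
case \<open>m = 1\<close>.\<close>

section \<open>Alternating signs and cells\<close>

text \<open>Going from right to left, starting below \<open>b\<close>, there are \<open>n\<close> points of \<open>X\<close> at which \<open>W\<close> takes
the signs of \<open>s, - s, s, \<dots>\<close>. The rightmost point comes first because the right end of the interval
of radii always carries the boundary condition, while the left end may be the origin.\<close>

primrec alternates :: "real set \<Rightarrow> (real \<Rightarrow> real) \<Rightarrow> nat \<Rightarrow> real \<Rightarrow> real \<Rightarrow> bool" where
  "alternates X W 0 s b \<longleftrightarrow> True"
| "alternates X W (Suc n) s b \<longleftrightarrow> (\<exists>y\<in>X. y < b \<and> 0 < s * W y \<and> alternates X W n (- s) y)"

lemma alternates_mono: "alternates X W n s b \<Longrightarrow> b \<le> b' \<Longrightarrow> alternates X W n s b'"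
  by (cases n) (auto intro: less_le_trans)

text \<open>A set of points on which \<open>W\<close> does not change sign can contribute only one of the alternating points;
discarding that point leaves an alternation to the left of the set.\<close>

lemma alternates_drop_cell:
  assumes cell: "\<And>x y. x \<in> X \<Longrightarrow> y \<in> X \<Longrightarrow> l \<le> x \<Longrightarrow> x < b \<Longrightarrow> l \<le> y \<Longrightarrow> y < b \<Longrightarrow> 0 \<le> W x * W y"
    and alt: "alternates X W (Suc n) s b"
  shows "alternates X W n (- s) l"
proof (cases n)
  case (Suc k)
  from alt Suc obtain y y' where y: "y \<in> X" "y < b" "0 < s * W y"
    and y': "y' \<in> X" "y' < y" "0 < - s * W y'" "alternates X W k s y'" by auto
  have "y' < l"
  proof (rule ccontr)
    assume "\<not> y' < l"
    then have "0 \<le> W y * W y'" using y y' by (intro cell) auto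
    moreover have "0 < (s * W y) * (- s * W y')" by (rule mult_pos_pos[OF y(3) y'(3)])
    then have "0 < - ((s * s) * (W y * W y'))" by (simp add: algebra_simps)
    moreover have "0 \<le> (s * s) * (W y * W y')"
      using \<open>0 \<le> W y * W y'\<close> by (rule mult_nonneg_nonneg[rotated]) simp
    ultimately show False by linarith
  qed
  then show ?thesis using Suc y' by auto
qed simp

lemma alternates_cells_le:
  assumes base: "\<And>x. x \<in> X \<Longrightarrow> z 0 \<le> x"
    and cell: "\<And>i x y. i < j \<Longrightarrow> x \<in> X \<Longrightarrow> y \<in> X \<Longrightarrow> z i \<le> x \<Longrightarrow> x < z (Suc i)
      \<Longrightarrow> z i \<le> y \<Longrightarrow> y < z (Suc i) \<Longrightarrow> 0 \<le> W x * W y"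
    and alt: "alternates X W n s (z j)"
  shows "n \<le> j"
  using cell alt
proof (induction j arbitrary: n s)
  case 0
  then show ?case using base by (cases n) force+
next
  case (Suc j)
  show ?case
  proof (cases n)
    case (Suc k)
    have "alternates X W k (- s) (z j)"
      using Suc.prems(2) unfolding Suc
      by (rule alternates_drop_cell[rotated]) (rule Suc.prems(1)[of j]; simp)
    then have "k \<le> j" by (rule Suc.IH[rotated]) (rule Suc.prems(1)[OF less_SucI])
    then show ?thesis using Suc by simp
  qed simp
qed

text \<open>As many alternating points as cells leave no freedom: each cell contains exactly one of them, which
determines the sign of \<open>W\<close> there.\<close>

lemma alternates_cells_eq:
  assumes base: "\<And>x. x \<in> X \<Longrightarrow> z 0 \<le> x"
    and cell: "\<And>i x y. i < j \<Longrightarrow> x \<in> X \<Longrightarrow> y \<in> X \<Longrightarrow> z i \<le> x \<Longrightarrow> x < z (Suc i)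
      \<Longrightarrow> z i \<le> y \<Longrightarrow> y < z (Suc i) \<Longrightarrow> 0 \<le> W x * W y"
    and alt: "alternates X W j s (z j)" and i: "i < j"
  shows "\<exists>y\<in>X. z i \<le> y \<and> y < z (Suc i) \<and> 0 < s * (- 1) ^ (j - Suc i) * W y"
  using cell alt i
proof (induction j arbitrary: s)
  case (Suc j)
  from Suc.prems(2) obtain y where y: "y \<in> X" "y < z (Suc j)" "0 < s * W y" 
    "alternates X W j (- s) y" by auto
  have drop: "alternates X W j (- s) (z j)"
    using Suc.prems(2) by (rule alternates_drop_cell[rotated]) (rule Suc.prems(1)[of j]; simp)
  have "z j \<le> y"
  proof (rule ccontr)
    assume "\<not> z j \<le> y"
    then have "alternates X W (Suc j) s (z j)" using y by (auto intro!: bexI[of _ y])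
    then have "Suc j \<le> j"
      by (rule alternates_cells_le[rotated 2]) (rule base, assumption, rule Suc.prems(1)[OF less_SucI])
    then show False by simp
  qed
  show ?case
  proof (cases "i = j")
    case True
    then show ?thesis using y \<open>z j \<le> y\<close> by auto
  next
    case False
    then have ij: "i < j" using Suc.prems(3) by simp
    then have "Suc j - Suc i = Suc (j - Suc i)" by simp
    moreover have "\<exists>y\<in>X. z i \<le> y \<and> y < z (Suc i) \<and> 0 < - s * (- 1) ^ (j - Suc i) * W y"
      using ij drop by (intro Suc.IH) (auto intro: Suc.prems(1)[OF less_SucI])
    ultimately show ?thesis by simp
  qed
qed simp

lemma same_sign_if_no_zero:
  fixes W :: "real \<Rightarrow> real"
  assumes "continuous_on {x..y} W" "x \<le> y" "\<And>r. x \<le> r \<Longrightarrow> r \<le> y \<Longrightarrow> W r \<noteq> 0"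
  shows "0 < W x * W y"
proof (rule ccontr)
  assume "\<not> 0 < W x * W y"
  then have "W x \<le> 0 \<and> 0 \<le> W y \<or> W y \<le> 0 \<and> 0 \<le> W x" by (auto simp: not_less mult_le_0_iff)
  then show False using IVT'[of W x 0 y] IVT2'[of W y 0 x] assms by blast
qed

section \<open>Listing the zeros of a function\<close>

text \<open>The zeros in \<open>D\<close> are \<open>z 1 < \<dots> < z (m - 1)\<close>, and \<open>z 0\<close>, \<open>z m\<close> close off the first and the
last zone, so that the zones are the sets \<open>D \<inter> {z i<..<z (Suc i)}\<close> for \<open>i < m\<close>. When \<open>D\<close> contains
its left end \<open>a\<close> (the origin of a ball), \<open>z 0\<close> is placed below \<open>a\<close> so that the first zone contains
\<open>a\<close>; the condition \<open>a < z 1\<close> says that \<open>a\<close> is not itself a zero.\<close>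

definition lists_zeros :: "real \<Rightarrow> real \<Rightarrow> real set \<Rightarrow> (real \<Rightarrow> real) \<Rightarrow> nat \<Rightarrow> (nat \<Rightarrow> real) \<Rightarrow> bool" where
  "lists_zeros a R D W m z \<longleftrightarrow>
     1 \<le> m \<and> strict_mono_on {..m} z \<and> z 0 = (if a \<in> D then a - 1 else a) \<and> z m = R \<and> a < z 1 \<and>
     {r \<in> D. W r = 0} = z ` {1..<m}"

lemma strict_mono_on_atMostD: "strict_mono_on {..m} z \<Longrightarrow> i < j \<Longrightarrow> j \<le> m \<Longrightarrow> z i < (z j :: real)" for i j m :: nat
  by (rule strict_mono_onD[of "{..m}"]) auto

lemma cell_exists:
  fixes z :: "nat \<Rightarrow> real"
  assumes "z 0 \<le> x" "x < z m"
  shows "\<exists>i<m. z i \<le> x \<and> x < z (Suc i)"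
  using assms
proof (induction m)
  case (Suc m)
  show ?case
  proof (cases "x < z m")
    case True
    then show ?thesis using Suc by (meson less_Suc_eq)
  qed (use Suc in auto)
qed simp

lemma lists_zeros_exists:
  assumes fin: "finite {r \<in> D. W r = 0}" and aR: "a < R" and D: "D = {a<..<R} \<or> D = {a..<R}"
    and Wa: "a \<in> D \<Longrightarrow> W a \<noteq> 0"
  shows "\<exists>w. lists_zeros a R D W (Suc (card {r \<in> D. W r = 0})) w"
proof -
  define Z where "Z = {r \<in> D. W r = 0}"
  define l where "l = (if a \<in> D then a - 1 else a)"
  define xs where "xs = sorted_list_of_set Z"
  define ys where "ys = l # xs @ [R]"
  have Z: "a < r \<and> r < R" if "r \<in> Z" for r
  proof -
    have "r \<noteq> a" using Wa that by (auto simp: Z_def)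
    then show ?thesis using that D by (auto simp: Z_def)
  qed
  have xs: "set xs = Z" "length xs = card Z" "sorted_wrt (<) xs"
    using fin by (auto simp: xs_def Z_def strict_sorted_list_of_set)
  have "l \<le> a" by (simp add: l_def)
  have sorted: "sorted_wrt (<) ys"
    using xs Z aR \<open>l \<le> a\<close> by (force simp: ys_def sorted_wrt_append)
  have len: "length ys = Suc (Suc (card Z))" using xs by (simp add: ys_def)
  have mid: "ys ! i = xs ! (i - 1)" if "1 \<le> i" "i < Suc (card Z)" for i
    using that xs by (cases i) (auto simp: ys_def nth_append)
  have last: "ys ! Suc (card Z) = R" using xs by (simp add: ys_def nth_append)
  have "strict_mono_on {..Suc (card Z)} (\<lambda>i. ys ! i)"
    by (rule strict_mono_onI) (use sorted len in \<open>auto simp: sorted_wrt_iff_nth_less\<close>)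
  moreover have "a < ys ! 1"
  proof (cases "card Z = 0")
    case True
    then show ?thesis using last aR by simp
  next
    case False
    then have "ys ! 1 \<in> Z" using mid[of 1] xs nth_mem[of 0 xs] by simp
    then show ?thesis using Z by auto
  qed
  moreover have "Z = (\<lambda>i. ys ! i) ` {1..<Suc (card Z)}"
  proof -
    have "{1..<Suc (card Z)} = Suc ` {..<card Z}"
      by (simp add: image_Suc_lessThan atLeastLessThanSuc_atLeastAtMost)
    then have "(\<lambda>i. ys ! i) ` {1..<Suc (card Z)} = (\<lambda>i. ys ! Suc i) ` {..<card Z}"
      by (simp only: image_image)
    also have "\<dots> = (\<lambda>i. xs ! i) ` {..<card Z}" using mid by (intro image_cong) auto
    also have "\<dots> = set xs" using xs(2) by (auto simp: set_conv_nth)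
    finally show ?thesis using xs by simp
  qed
  ultimately have "lists_zeros a R D W (Suc (card Z)) (\<lambda>i. ys ! i)"
    using last unfolding lists_zeros_def Z_def[symmetric] by (simp add: ys_def l_def)
  then show ?thesis unfolding Z_def by blast
qed

section \<open>One equation in flux form\<close>

text \<open>A difference quotient at an end point is controlled by the derivative inside the interval, although
the derivative at the end point need not exist.\<close>

lemma derivative_bounded_away:
  fixes f f' :: "real \<Rightarrow> real"
  assumes xy: "x < y" and cont: "continuous_on {x..y} f"
    and deriv: "\<And>r. x < r \<Longrightarrow> r < y \<Longrightarrow> (f has_real_derivative f' r) (at r)"
    and bound: "\<And>r. x < r \<Longrightarrow> r < y \<Longrightarrow> \<kappa> \<le> s * f' r" and pos: "0 < \<kappa>"
    and e: "e = x \<or> e = y" and sub: "{x..y} \<subseteq> S"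
  shows "\<not> (f has_real_derivative 0) (at e within S)"
proof
  assume "(f has_real_derivative 0) (at e within S)"
  then have "(f has_real_derivative 0) (at e within {x..y})" by (rule DERIV_subset) (fact sub)
  then have lim: "((\<lambda>r. s * ((f r - f e) / (r - e))) \<longlongrightarrow> s * 0) (at e within {x..y})"
    by (intro tendsto_mult tendsto_const) (simp add: has_field_derivative_iff)
  have quotient: "\<kappa> \<le> s * ((f r - f t) / (r - t))" if "x \<le> t" "t < r" "r \<le> y" for r t
  proof -
    have "\<exists>l q. t < q \<and> q < r \<and> (f has_real_derivative l) (at q) \<and> f r - f t = (r - t) * l"
    proof (rule MVT[OF that(2)])
      show "continuous_on {t..r} f" using that by (intro continuous_on_subset[OF cont]) auto
      fix q assume "t < q" "q < r"
      then have "(f has_real_derivative f' q) (at q)" using that by (intro deriv) auto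
      then show "f differentiable at q" by (auto simp: real_differentiable_def)
    qed
    then obtain l q where q: "t < q" "q < r" "(f has_real_derivative l) (at q)" "f r - f t = (r - t) * l" by blast
    then have "l = f' q" using DERIV_unique[OF q(3) deriv] that by simp
    then show ?thesis using q that bound[of q] by simp
  qed
  have "\<forall>\<^sub>F r in at e within {x..y}. \<kappa> \<le> s * ((f r - f e) / (r - e))"
    unfolding eventually_at_filter
  proof (intro always_eventually allI impI)
    fix r assume r: "r \<noteq> e" "r \<in> {x..y}"
    have swap: "(f r - f e) / (r - e) = (f e - f r) / (e - r)"
      using minus_divide_divide[of "f r - f e" "r - e"] by simp
    show "\<kappa> \<le> s * ((f r - f e) / (r - e))"
      using r e xy quotient[of e r] quotient[of r e] unfolding swap
      by (cases "r < e") (use swap in auto)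
  qed
  moreover have "at e within {x..y} \<noteq> bot"
    using e xy by (auto simp: trivial_limit_within islimpt_Icc)
  ultimately have "\<kappa> \<le> s * 0" by (intro tendsto_lowerbound[OF lim])
  then show False using pos by simp
qed

text \<open>One of the two radial equations: \<open>- (r\<^sup>k U')' = F\<close>, with \<open>F\<close> weakly of the sign of \<open>V\<close>. The two
shapes of \<open>D\<close> are the shell, with its Dirichlet condition at the inner radius, and the ball, where the
origin is a critical point. The factor \<open>s\<close> in the assumption \<open>sign\<close> covers both signs at once; if
\<open>V\<close> vanishes on an interval, both together give \<open>F = 0\<close> there. Every lemma below carries such a
factor, so that it holds for \<open>U\<close> and \<open>- U\<close> alike.\<close>

locale flux_equation =
  fixes a R :: real and D :: "real set" and k :: nat and U U' F V :: "real \<Rightarrow> real"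
  assumes a_nonneg: "0 \<le> a" and a_less_R: "a < R"
    and left: "D = {a<..<R} \<and> U a = 0 \<or> D = {a..<R} \<and> U' a = 0"
    and right: "U R = 0"
    and cont: "continuous_on {a..R} U"
    and deriv: "\<And>r. r \<in> D \<Longrightarrow> (U has_real_derivative U' r) (at r within {a..R})"
    and cont': "continuous_on D U'"
    and flux_deriv: "\<And>r. a < r \<Longrightarrow> r < R \<Longrightarrow> ((\<lambda>r. r ^ k * U' r) has_real_derivative - F r) (at r)"
    and sign: "\<And>s x y r. a \<le> x \<Longrightarrow> y \<le> R \<Longrightarrow> (\<And>r. x < r \<Longrightarrow> r < y \<Longrightarrow> 0 \<le> s * V r)
      \<Longrightarrow> x < r \<Longrightarrow> r < y \<Longrightarrow> 0 \<le> s * F r"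
    and strict: "\<And>x y. a \<le> x \<Longrightarrow> x < y \<Longrightarrow> y \<le> R \<Longrightarrow> (\<And>r. x < r \<Longrightarrow> r < y \<Longrightarrow> U r \<noteq> 0 \<and> V r \<noteq> 0)
      \<Longrightarrow> \<exists>r. x < r \<and> r < y \<and> F r \<noteq> 0"
begin

definition flux :: "real \<Rightarrow> real" where "flux r = r ^ k * U' r"

definition crit :: "real set" where "crit = {r \<in> D. U' r = 0}"

lemma D_bounds: "r \<in> D \<Longrightarrow> a \<le> r" "r \<in> D \<Longrightarrow> r < R" "a < r \<Longrightarrow> r < R \<Longrightarrow> r \<in> D"
  using left by auto

lemma D_between: "x \<in> D \<Longrightarrow> x \<le> r \<Longrightarrow> r < R \<Longrightarrow> r \<in> D"
  using left by auto

lemma critI: "r \<in> D \<Longrightarrow> U' r = 0 \<Longrightarrow> r \<in> crit"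
  by (simp add: crit_def)

lemma crit_subset: "crit \<subseteq> D"
  by (auto simp: crit_def)

lemma left_end_critical: "a \<in> D \<Longrightarrow> a \<in> crit"
  using left by (intro critI) auto

lemma flux_zero_iff: "r \<in> D \<Longrightarrow> flux r = 0 \<longleftrightarrow> U' r = 0"
  using left a_nonneg unfolding flux_def by (cases "r = a") auto

lemma flux_pos_iff:
  assumes "a < r"
  shows "0 \<le> s * flux r \<longleftrightarrow> 0 \<le> s * U' r"
proof -
  have "0 < r ^ k" using assms a_nonneg by simp
  moreover have "s * flux r = r ^ k * (s * U' r)" by (simp add: flux_def)
  ultimately show ?thesis by (metis mult_le_cancel_left_pos mult_zero_right)
qed

lemma deriv_interior: "a < r \<Longrightarrow> r < R \<Longrightarrow> (U has_real_derivative U' r) (at r)"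
  using deriv[of r] D_bounds(3)[of r] by (simp add: at_within_Icc_at)

lemma flux_mono:
  assumes "x \<in> D" "y \<in> D" "x \<le> y" "\<And>r. x < r \<Longrightarrow> r < y \<Longrightarrow> s * V r \<le> 0"
  shows "s * flux x \<le> s * flux y"
proof (rule DERIV_nonneg_imp_increasing_open[of x y "\<lambda>r. s * flux r"])
  fix r assume r: "x < r" "r < y"
  then have ar: "a < r" "r < R" using assms D_bounds(1)[of x] D_bounds(2)[of y] by auto
  have "0 \<le> - s * F r"
    by (rule sign[of x y "- s" r]) (use assms r D_bounds(1)[of x] D_bounds(2)[of y] in auto)
  moreover have "((\<lambda>r. s * flux r) has_real_derivative s * - F r) (at r)"
    unfolding flux_def by (rule DERIV_cmult[OF flux_deriv[OF ar]])
  ultimately show "\<exists>l. ((\<lambda>r. s * flux r) has_real_derivative l) (at r) \<and> 0 \<le> l" by auto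
next
  have "{x..y} \<subseteq> D" using assms D_between[of x] D_bounds(2)[of y] by auto
  then show "continuous_on {x..y} (\<lambda>r. s * flux r)" unfolding flux_def
    by (intro continuous_intros continuous_on_subset[OF cont'])
qed (fact assms)

lemma U_mono:
  assumes "a \<le> x" "x \<le> y" "y \<le> R" "\<And>r. x < r \<Longrightarrow> r < y \<Longrightarrow> 0 \<le> s * U' r"
  shows "s * U x \<le> s * U y"
proof (rule DERIV_nonneg_imp_increasing_open[of x y "\<lambda>r. s * U r"])
  fix r assume r: "x < r" "r < y"
  then have "((\<lambda>r. s * U r) has_real_derivative s * U' r) (at r)"
    using assms by (intro DERIV_cmult deriv_interior) auto
  then show "\<exists>l. ((\<lambda>r. s * U r) has_real_derivative l) (at r) \<and> 0 \<le> l" using assms(4) r by auto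
next
  show "continuous_on {x..y} (\<lambda>r. s * U r)" using assms
    by (intro continuous_intros continuous_on_subset[OF cont]) auto
qed (fact assms)

lemma U_constant:
  assumes "a \<le> x" "x \<le> r" "r \<le> R" "\<And>t. x < t \<Longrightarrow> t < r \<Longrightarrow> U' t = 0"
  shows "U r = U x"
  using U_mono[of x r 1] U_mono[of x r "-1"] assms by auto

text \<open>The flux is monotone where \<open>V\<close> has a sign, and it vanishes at both ends.\<close>

lemma flat_between_critical:
  assumes x: "x \<in> crit" and y: "y \<in> crit" and s: "s \<noteq> 0"
    and V: "\<And>r. x < r \<Longrightarrow> r < y \<Longrightarrow> 0 \<le> s * V r" and r: "x \<le> r" "r \<le> y"
  shows "U' r = 0" "U r = U x"
proof -
  have zero: "U' t = 0" if t: "x \<le> t" "t \<le> y" for t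
  proof -
    have D: "x \<in> D" "y \<in> D" "t \<in> D"
      using x y t D_between[of x t] D_bounds(2)[of y] by (auto simp: crit_def)
    have "- s * flux x \<le> - s * flux t" "- s * flux t \<le> - s * flux y"
      using D t V by (intro flux_mono; force)+
    moreover have "flux x = 0" "flux y = 0" using x y flux_zero_iff by (auto simp: crit_def)
    ultimately have "flux t = 0" using s by auto
    then show ?thesis using D flux_zero_iff by simp
  qed
  then show "U' r = 0" using r by simp
  show "U r = U x"
    using r x y D_bounds(1)[of x] D_bounds(2)[of y] zero by (intro U_constant) (auto simp: crit_def)
qed

text \<open>If \<open>V\<close> had the opposite sign between \<open>c\<close> and \<open>b\<close>, the flux would start from \<open>0\<close> at \<open>c\<close> and push
\<open>U\<close> further away from \<open>0\<close>, so \<open>U\<close> could not return to \<open>0\<close> at \<open>b\<close>.\<close>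

lemma other_sign_after_critical:
  assumes c: "c \<in> crit" and b: "c < b" "b \<le> R" and U: "0 < s * U c" "s * U b \<le> 0"
  shows "\<exists>x. c < x \<and> x < b \<and> 0 < s * V x"
proof (rule ccontr)
  assume "\<not> ?thesis"
  then have V: "s * V x \<le> 0" if "c < x" "x < b" for x using that by force
  have cD: "c \<in> D" "U' c = 0" using c by (auto simp: crit_def)
  have "s * U c \<le> s * U b"
  proof (rule U_mono)
    fix r assume r: "c < r" "r < b"
    have "s * flux c \<le> s * flux r"
      using cD r b V D_between[of c r] by (intro flux_mono) auto
    then have "0 \<le> s * flux r" using cD flux_zero_iff[of c] by simp
    then show "0 \<le> s * U' r" using flux_pos_iff[of r s] r D_bounds(1)[OF cD(1)] by auto
  qed (use cD b D_bounds(1) in auto)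
  then show False using U by simp
qed

lemma both_signs_between_critical:
  assumes c: "c \<in> crit" and d: "d \<in> crit" and e: "c < e" "e < d" "U e \<noteq> U c" and s: "s \<noteq> 0"
  shows "\<exists>x. c < x \<and> x < d \<and> 0 < s * V x"
proof (rule ccontr)
  assume "\<not> ?thesis"
  then have V: "0 \<le> - s * V x" if "c < x" "x < d" for x using that by force
  have "U e = U c" by (rule flat_between_critical(2)[OF c d, of "- s"]) (use V s e in auto)
  then show False using e by simp
qed

lemma interior_max_critical:
  assumes lb: "a \<le> l" "l < c" "c < b" "b \<le> R" and max: "\<And>y. l \<le> y \<Longrightarrow> y \<le> b \<Longrightarrow> s * U y \<le> s * U c"
    and s: "s \<noteq> 0"
  shows "c \<in> crit"
proof -
  have "((\<lambda>r. s * U r) has_real_derivative s * U' c) (at c)"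
    using lb by (intro DERIV_cmult deriv_interior) auto
  moreover have "\<forall>y. \<bar>c - y\<bar> < min (c - l) (b - c) \<longrightarrow> s * U y \<le> s * U c"
    by (intro allI impI max) linarith+
  ultimately have "s * U' c = 0"
    using lb by (intro DERIV_local_max[of _ _ _ "min (c - l) (b - c)"]) auto
  then show ?thesis using s lb by (intro critI D_bounds(3)) auto
qed

text \<open>Between two points of the opposite sign (or an end of the interval) the extremum of \<open>U\<close> is attained
at a critical point, so alternating points can be moved to critical points. Only the leftmost extremum
can touch the left end, and it does so only in a ball, where the origin is critical.\<close>

lemma alternates_critical:
  assumes "alternates D U n s b" "a < b" "b \<le> R" "s * U b \<le> 0"
  shows "alternates crit U n s b"
  using assms
proof (induction n arbitrary: s b)
  case (Suc n)
  from Suc.prems(1) obtain y where y: "y \<in> D" "y < b" "0 < s * U y" "alternates D U n (- s) y" by auto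
  have attains: "\<exists>c\<ge>l. c \<le> b \<and> (\<forall>t\<in>{l..b}. s * U t \<le> s * U c)" if "a \<le> l" "l \<le> y" for l
  proof -
    have "continuous_on {l..b} (\<lambda>r. s * U r)"
      using that Suc.prems(3) by (intro continuous_intros continuous_on_subset[OF cont]) auto
    then obtain c where "c \<in> {l..b}" "\<forall>t\<in>{l..b}. s * U t \<le> s * U c"
      using continuous_attains_sup[of "{l..b}" "\<lambda>r. s * U r"] \<open>l \<le> y\<close> y(2) by auto
    then show ?thesis by (intro exI[of _ c]) simp
  qed
  have ya: "a \<le> y" using y D_bounds by auto
  have s: "s \<noteq> 0" using y by auto
  have "\<exists>c\<in>crit. c < b \<and> 0 < s * U c \<and> alternates D U n (- s) c"
  proof (cases n)
    case 0
    obtain c where c: "a \<le> c" "c \<le> b" "\<forall>t\<in>{a..b}. s * U t \<le> s * U c" using attains[of a] ya by auto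
    have Uc: "0 < s * U c" using c(3) y ya by force
    then have "c \<noteq> b" using Suc.prems(4) by force
    then have "c < b" using c by simp
    moreover have "c \<in> crit"
    proof (cases "c = a")
      case True
      then have "U' a = 0" "a \<in> D" using left Uc a_less_R by auto
      then show ?thesis unfolding True by (intro critI)
    next
      case False
      then show ?thesis
        by (intro interior_max_critical[of a c b s]) (use c \<open>c < b\<close> Suc.prems(3) s in simp_all)
    qed
    ultimately show ?thesis using Uc 0 by auto
  next
    case (Suc k)
    then obtain y' where y': "y' \<in> D" "y' < y" "0 < - s * U y'" "alternates D U k s y'" using y by auto
    obtain c where c: "y' \<le> c" "c \<le> b" "\<forall>t\<in>{y'..b}. s * U t \<le> s * U c"
      using attains[of y'] y' D_bounds by auto
    have "s * U y \<le> s * U c" using c(3) y(2) y'(2) by simp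
    then have Uc: "0 < s * U c" using y(3) by linarith
    have "c \<noteq> b" using Uc Suc.prems(4) by force
    moreover have "c \<noteq> y'" using Uc y'(3) by force
    ultimately have "c < b" "y' < c" using c by auto
    moreover have "c \<in> crit"
      by (intro interior_max_critical[of y' c b s])
        (use c \<open>c < b\<close> \<open>y' < c\<close> Suc.prems(3) s D_bounds(1)[OF y'(1)] in simp_all)
    moreover have "alternates D U n (- s) c" using Suc y' \<open>y' < c\<close> by auto
    ultimately show ?thesis using Uc by blast
  qed
  then obtain c where c: "c \<in> crit" "c < b" "0 < s * U c" "alternates D U n (- s) c" by auto
  have "alternates crit U n (- s) c"
  proof (cases n)
    case (Suc k)
    then have "a < c" using c(4) D_bounds by force
    then show ?thesis by (intro Suc.IH) (use c Suc.prems(3) in simp_all)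
  qed simp
  then show ?case using c by auto
qed simp

text \<open>Each critical point is followed, before \<open>U\<close> loses its sign, by a point where \<open>V\<close> has that sign.\<close>

lemma alternates_critical_other:
  assumes "alternates crit U n s b" "b \<le> R" "s * U b \<le> 0"
  shows "alternates D V n s b"
  using assms
proof (induction n arbitrary: s b)
  case (Suc n)
  from Suc.prems(1) obtain c where c: "c \<in> crit" "c < b" "0 < s * U c" "alternates crit U n (- s) c" by auto
  from other_sign_after_critical[OF c(1,2) Suc.prems(2) c(3) Suc.prems(3)] obtain x where
    x: "c < x" "x < b" "0 < s * V x" by auto
  have "alternates D V n (- s) c" by (intro Suc.IH) (use c Suc.prems(2) in simp_all)
  then have "alternates D V n (- s) x" by (rule alternates_mono) (use x in simp)
  moreover have "x \<in> D"
    using D_between[of c x] c(1) x(1,2) Suc.prems(2) by (simp add: crit_def)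
  ultimately show ?case using x by auto
qed simp

lemma alternates_transfer: "alternates D U n s R \<Longrightarrow> alternates D V n s R"
  using alternates_critical_other alternates_critical right a_less_R by simp

context
  fixes m :: nat and z :: "nat \<Rightarrow> real"
  assumes z: "lists_zeros a R D U m z"
begin

lemma z_facts: "1 \<le> m" "z m = R" "i < j \<Longrightarrow> j \<le> m \<Longrightarrow> z i < z j" "z 0 \<notin> D" "x \<in> D \<Longrightarrow> z 0 < x" "z 0 \<le> a"
  using z left by (auto simp: lists_zeros_def strict_mono_on_atMostD split: if_splits)

lemma z_zero: "1 \<le> i \<Longrightarrow> i < m \<Longrightarrow> z i \<in> D \<and> U (z i) = 0"
  using z unfolding lists_zeros_def by force

lemma z_le: "i \<le> m \<Longrightarrow> z i \<le> R"
  using z_facts(2,3) by (cases "i = m") (auto intro: less_imp_le)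

lemma z_mono: "i \<le> j \<Longrightarrow> j \<le> m \<Longrightarrow> z i \<le> z j"
  using z_facts(3)[of i j] by (cases "i = j") auto

lemma cell_unique:
  assumes "i < m" "j < m" "z i < x" "x < z (Suc i)" "z j < x" "x < z (Suc j)"
  shows "i = j"
  using assms z_mono[of "Suc i" j] z_mono[of "Suc j" i] by (cases i j rule: linorder_cases) auto

lemma open_cell_nonzero:
  assumes "i < m" "z i < x" "x < z (Suc i)" "x \<in> D"
  shows "U x \<noteq> 0"
proof
  assume "U x = 0"
  then have "x \<in> z ` {1..<m}" using assms(4) z by (auto simp: lists_zeros_def)
  then obtain j where j: "x = z j" "j < m" by auto
  then have "\<not> j \<le> i" "\<not> Suc i \<le> j"
    using z_mono[of j i] z_mono[of "Suc i" j] assms by auto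
  then show False by simp
qed

lemma open_cell_same_sign:
  assumes "i < m" "z i < x" "x < z (Suc i)" "x \<in> D" "z i < y" "y < z (Suc i)" "y \<in> D"
  shows "0 < U x * U y"
proof -
  have *: "0 < U x * U y" if "x \<le> y" "z i < x" "x \<in> D" "y < z (Suc i)" "y \<in> D" for x y
  proof (rule same_sign_if_no_zero[of x y U])
    show "continuous_on {x..y} U" using D_bounds[of x] D_bounds(2)[of y] that
      by (intro continuous_on_subset[OF cont]) auto
    fix r assume "x \<le> r" "r \<le> y"
    then show "U r \<noteq> 0" using that assms(1) D_between[of x r] D_bounds(2)[of y]
      by (intro open_cell_nonzero[of i]) auto
  qed (fact that)
  show ?thesis using *[of x y] *[of y x] assms by (cases "x \<le> y") (auto simp: mult.commute)
qed

lemma cell_start: "i < m \<Longrightarrow> z i \<in> D \<Longrightarrow> U (z i) = 0"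
  using z_zero[of i] z_facts(4) by (cases "i = 0") auto

lemma cell_same_sign:
  assumes "i < m" "z i \<le> x" "x < z (Suc i)" "x \<in> D" "z i \<le> y" "y < z (Suc i)" "y \<in> D"
  shows "0 \<le> U x * U y"
proof (cases "x = z i \<or> y = z i")
  case True
  then show ?thesis using cell_start[of i] assms by auto
next
  case False
  then show ?thesis using open_cell_same_sign[of i x y] assms by auto
qed

lemma alternates_le_cells: "alternates D U n s R \<Longrightarrow> n \<le> m"
  unfolding z_facts(2)[symmetric]
  by (erule alternates_cells_le[rotated 2]) (auto intro: cell_same_sign less_imp_le[OF z_facts(5)])

text \<open>In particular consecutive zones have opposite signs: none of the zeros is a touching point.\<close>

lemma sign_on_cell:
  assumes alt: "alternates D U m s R" and i: "i < m" and x: "x \<in> D" "z i < x" "x < z (Suc i)"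
  shows "0 < s * (- 1) ^ (m - Suc i) * U x"
proof -
  have "\<exists>y\<in>D. z i \<le> y \<and> y < z (Suc i) \<and> 0 < s * (- 1) ^ (m - Suc i) * U y"
    using alt i unfolding z_facts(2)[symmetric]
    by (intro alternates_cells_eq[of D z m U s i]) (auto intro: cell_same_sign less_imp_le[OF z_facts(5)])
  then obtain y where y: "y \<in> D" "z i \<le> y" "y < z (Suc i)" "0 < s * (- 1) ^ (m - Suc i) * U y" by auto
  then have "y \<noteq> z i" using cell_start[OF i] by auto
  then have "0 < U x * U y" using open_cell_same_sign[OF i, of x y] x y by auto
  with y(4) show ?thesis by (auto simp: zero_less_mult_iff)
qed

text \<open>Rolle's theorem, except in the first zone of a ball, where the origin is the critical point.\<close>

lemma critical_in_cell:
  assumes "i < m"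
  shows "\<exists>c\<in>crit. z i < c \<and> c < z (Suc i)"
proof (cases "i = 0 \<and> a \<in> D")
  case True
  then have "a \<in> crit" using left critI by auto
  moreover have "a < z (Suc i)" using z True by (simp add: lists_zeros_def)
  ultimately show ?thesis using True z_facts(5) by blast
next
  case False
  have ends: "U (z i) = 0" "a \<le> z i" "U (z (Suc i)) = 0"
  proof -
    have "U (z i) = 0 \<and> a \<le> z i"
    proof (cases "i = 0")
      case True
      then have "a \<notin> D" "z i = a" using False z by (auto simp: lists_zeros_def)
      then show ?thesis using left a_less_R by auto
    next
      case False
      then show ?thesis using z_zero[of i] assms D_bounds(1)[of "z i"] by simp
    qed
    then show "U (z i) = 0" "a \<le> z i" by auto
    show "U (z (Suc i)) = 0" using z_zero[of "Suc i"] assms right z_facts(2)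
      by (cases "Suc i = m") auto
  qed
  have lt: "z i < z (Suc i)" using z_facts(3) assms by auto
  have up: "z (Suc i) \<le> R" using z_le[of "Suc i"] assms by simp
  have "\<exists>c>z i. c < z (Suc i) \<and> (U has_real_derivative 0) (at c)"
  proof (rule Rolle[OF lt])
    show "continuous_on {z i..z (Suc i)} U" using ends up by (intro continuous_on_subset[OF cont]) auto
    fix x assume "z i < x" "x < z (Suc i)"
    then have "(U has_real_derivative U' x) (at x)" using ends up by (intro deriv_interior) auto
    then show "U differentiable at x" by (auto simp: real_differentiable_def)
  qed (use ends in simp)
  then obtain c where c: "z i < c" "c < z (Suc i)" "(U has_real_derivative 0) (at c)" by blast
  have "a < c" "c < R" using c ends z_le[of "Suc i"] assms by auto
  then have "U' c = 0" using DERIV_unique[OF deriv_interior c(3)] by simp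
  then have "c \<in> crit" using \<open>a < c\<close> \<open>c < R\<close> by (intro critI D_bounds(3))
  then show ?thesis using c by auto
qed

text \<open>At this stage it is not known that \<open>U\<close> changes sign at its zeros, so the signs of \<open>V\<close> cannot be read
off those of \<open>U\<close>. But between consecutive critical points \<open>V\<close> takes both signs, and this is enough
to choose one point of the required sign in each of the \<open>m - 1\<close> gaps, with two in the first.
For \<open>m = 1\<close> there is no gap, and the return of \<open>U\<close> to \<open>0\<close> at \<open>R\<close> provides the single point.\<close>

lemma other_alternates: "\<exists>s. alternates D V m s R \<and> s \<noteq> 0"
proof -
  have "\<forall>i\<in>{..<m}. \<exists>c. c \<in> crit \<and> z i < c \<and> c < z (Suc i)"
    using critical_in_cell by blast
  then obtain c where c: "\<And>i. i < m \<Longrightarrow> c i \<in> crit \<and> z i < c i \<and> c i < z (Suc i)"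
    using bchoice[of "{..<m}" "\<lambda>i c. c \<in> crit \<and> z i < c \<and> c < z (Suc i)"] by auto
  have c_in: "c i \<in> D" "a \<le> c i" "c i < R" if "i < m" for i
    using c[OF that] D_bounds by (auto simp: crit_def)
  have Uc: "U (c i) \<noteq> 0" if "i < m" for i using open_cell_nonzero[of i "c i"] c c_in that by auto
  have both: "\<exists>x\<in>D. c i < x \<and> x < c (Suc i) \<and> 0 < s * V x" if "Suc i < m" "s \<noteq> 0" for i s
  proof -
    have "c i < z (Suc i)" "z (Suc i) < c (Suc i)" "U (z (Suc i)) = 0"
      using c[of i] c[of "Suc i"] that z_zero[of "Suc i"] by auto
    moreover have "c i \<in> crit" "c (Suc i) \<in> crit" "U (c i) \<noteq> 0" using c[of i] c[of "Suc i"] Uc[of i] that by auto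
    ultimately obtain x where x: "c i < x" "x < c (Suc i)" "0 < s * V x"
      using both_signs_between_critical[of "c i" "c (Suc i)" "z (Suc i)" s] \<open>s \<noteq> 0\<close> by auto
    moreover have "x \<in> D" using x c_in[of i] c_in[of "Suc i"] that D_between[of "c i" x] by auto
    ultimately show ?thesis by auto
  qed
  have step: "\<exists>s. alternates D V (Suc (Suc j)) s (c (Suc j))" if "Suc j < m" for j
    using that
  proof (induction j)
    case 0
    \<comment> \<open>The two points of the first gap come in an unknown order, which decides the sign of the alternation.\<close>
    obtain x where x: "x \<in> D" "x < c 1" "0 < V x" using both[of 0 1] 0 by auto
    obtain y where y: "y \<in> D" "y < c 1" "V y < 0" using both[of 0 "- 1"] 0 by auto
    show ?case
    proof (cases "x < y")
      case True
      then have "alternates D V (Suc 0) 1 y" using x by auto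
      then have "alternates D V (Suc (Suc 0)) (- 1) (c (Suc 0))" using y
        unfolding alternates.simps(2)[of D V "Suc 0"] by (intro bexI[of _ y]) simp_all
      then show ?thesis by blast
    next
      case False
      then have "y < x" using x y by (cases "x = y") auto
      then have "alternates D V (Suc 0) (- 1) x" using y by auto
      then have "alternates D V (Suc (Suc 0)) 1 (c (Suc 0))" using x
        unfolding alternates.simps(2)[of D V "Suc 0"] by (intro bexI[of _ x]) simp_all
      then show ?thesis by blast
    qed
  next
    case (Suc j)
    then obtain s where s: "alternates D V (Suc (Suc j)) s (c (Suc j))" by auto
    then have "s \<noteq> 0" by auto
    then obtain x where x: "x \<in> D" "c (Suc j) < x" "x < c (Suc (Suc j))" "0 < - s * V x"
      using both[of "Suc j" "- s"] Suc.prems by auto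
    have "alternates D V (Suc (Suc j)) (- (- s)) x"
      using alternates_mono[OF s, of x] x by simp
    then have "alternates D V (Suc (Suc (Suc j))) (- s) (c (Suc (Suc j)))"
      unfolding alternates.simps(2)[of D V "Suc (Suc j)"] using x by blast
    then show ?case by blast
  qed
  obtain s where s: "alternates D V m s R"
  proof (cases "m = 1")
    case True
    obtain x where "c 0 < x" "x < R" "0 < U (c 0) * V x"
      using other_sign_after_critical[of "c 0" R "U (c 0)"] c[of 0] c_in[of 0] Uc[of 0] True right by (auto simp: zero_less_mult_iff linorder_neq_iff)
    moreover then have "x \<in> D" using c_in[of 0] True D_between[of "c 0" x] by simp
    ultimately have "alternates D V m (U (c 0)) R" using True by auto
    then show ?thesis using that by blast
  next
    case False
    then obtain j where j: "m = Suc (Suc j)" using z_facts(1) by (metis One_nat_def not0_implies_Suc not_one_le_zero)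
    then obtain s where "alternates D V m s (c (Suc j))" using step[of j] by auto
    then show ?thesis using that alternates_mono c_in(3)[of "Suc j"] j by (metis less_imp_le lessI)
  qed
  moreover then have "s \<noteq> 0" using z_facts(1) by (cases m) auto
  ultimately show ?thesis by blast
qed

end

lemma Rolle_critical:
  assumes "x \<in> D" "y \<in> D" "x < y" "U x = U y"
  shows "\<exists>e\<in>crit. x < e \<and> e < y"
proof -
  have xy: "a \<le> x" "y < R" using assms D_bounds by auto
  have "\<exists>e>x. e < y \<and> (U has_real_derivative 0) (at e)"
  proof (rule Rolle[OF assms(3,4)])
    show "continuous_on {x..y} U" using xy by (intro continuous_on_subset[OF cont]) auto
    fix e assume "x < e" "e < y"
    then have "(U has_real_derivative U' e) (at e)" using xy by (intro deriv_interior) auto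
    then show "U differentiable at e" by (auto simp: real_differentiable_def)
  qed
  then obtain e where e: "x < e" "e < y" "(U has_real_derivative 0) (at e)" by blast
  then have "U' e = 0" using DERIV_unique[OF deriv_interior e(3)] xy by simp
  then have "e \<in> crit" using e xy by (intro critI D_bounds(3)) auto
  then show ?thesis using e by auto
qed

end

section \<open>Two coupled equations\<close>

text \<open>The facts about the equation for \<open>V\<close> carry the prefix \<open>other\<close>. The locale is symmetric under
exchange of the two equations (\<open>flip\<close>), so each lemma is proved for one order only.\<close>

locale radial_system = flux_equation a R D k U U' F V + other: flux_equation a R D k V V' G U
  for a R :: real and D :: "real set" and k :: nat and U U' F V V' G :: "real \<Rightarrow> real"
begin

lemma flip: "radial_system a R D k V V' G U U' F"
  by (rule radial_system.intro[OF other.flux_equation_axioms flux_equation_axioms])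

lemma flat_in_other_cell:
  assumes w: "lists_zeros a R D V m w" and i: "i < m"
    and x: "x \<in> crit" "w i \<le> x" and y: "y \<in> crit" "y \<le> w (Suc i)" and r: "x \<le> r" "r \<le> y"
  shows "U' r = 0 \<and> U r = U x"
proof (cases "x < y")
  case True
  have in_cell: "t \<in> D \<and> w i < t \<and> t < w (Suc i)" if "x < t" "t < y" for t
    using x y that D_between[of x t] D_bounds(2)[of y] by (auto simp: crit_def)
  have mid: "x < (x + y) / 2" "(x + y) / 2 < y" using True by auto
  have "0 \<le> V ((x + y) / 2) * V t" if "x < t" "t < y" for t
    using other.open_cell_same_sign[OF w i, of "(x + y) / 2" t] in_cell[OF that] in_cell[OF mid] by auto
  moreover have "V ((x + y) / 2) \<noteq> 0"
    using other.open_cell_nonzero[OF w i] in_cell[OF mid] by blast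
  ultimately show ?thesis
    using flat_between_critical[OF x(1) y(1), of "V ((x + y) / 2)" r] r by blast
next
  case False
  then have "r = x" using r by simp
  then show ?thesis using x by (simp add: crit_def)
qed

text \<open>Two critical points of \<open>U\<close> in one closed cell of \<open>V\<close> would make \<open>U\<close> constant between them. The
constant is not \<open>0\<close>, as \<open>U\<close> has finitely many zeros; then neither function vanishes in between, and
the flux cannot be constant.\<close>

lemma critical_unique_in_other_cell:
  assumes z: "lists_zeros a R D U m' z" and w: "lists_zeros a R D V m w" and i: "i < m"
    and x: "x \<in> crit" "w i \<le> x" "x \<le> w (Suc i)" and y: "y \<in> crit" "w i \<le> y" "y \<le> w (Suc i)"
  shows "x = y"
proof -
  have False if x: "x \<in> crit" "w i \<le> x" and y: "y \<in> crit" "y \<le> w (Suc i)" and "x < y" for x y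
  proof -
    have flat: "U' r = 0 \<and> U r = U x" if "x \<le> r" "r \<le> y" for r
      using flat_in_other_cell[OF w i x y] that by blast
    have bounds: "a \<le> x" "y < R" "x \<in> D" using x y D_bounds by (auto simp: crit_def)
    have in_D: "r \<in> D" if "x \<le> r" "r < y" for r using D_between[OF bounds(3)] bounds that by auto
    have Ux: "U x \<noteq> 0"
    proof
      assume "U x = 0"
      then have "{x..<y} \<subseteq> {r \<in> D. U r = 0}" using flat in_D by auto
      also have "\<dots> = z ` {1..<m'}" using z by (simp add: lists_zeros_def)
      finally have "finite {x..<y}" by (rule finite_subset) simp
      then show False using \<open>x < y\<close> by (simp add: infinite_Ico)
    qed
    have "\<exists>r. x < r \<and> r < y \<and> F r \<noteq> 0"
    proof (rule strict)
      fix r assume r: "x < r" "r < y"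
      show "U r \<noteq> 0 \<and> V r \<noteq> 0"
        using flat[of r] Ux r x y in_D[of r] other.open_cell_nonzero[OF w i, of r] by auto
    qed (use bounds \<open>x < y\<close> in auto)
    then obtain r where r: "x < r" "r < y" "F r \<noteq> 0" by blast
    have "((\<lambda>_. 0) has_real_derivative - F r) (at r)"
      by (rule has_field_derivative_transform_within_open[OF flux_deriv, of r "{x<..<y}"])
        (use r bounds flat in auto)
    then have "F r = 0" using DERIV_unique[OF _ DERIV_const] by fastforce
    then show False using r by simp
  qed
  from this[OF x(1,2) y(1,3)] this[OF y(1,2) x(1,3)] show ?thesis by force
qed

text \<open>The critical points \<open>c i\<close> found in the cells of \<open>U\<close> increase with \<open>i\<close>, and no closed cell of \<open>V\<close>
contains two of them. Hence each step from \<open>c i\<close> to \<open>c (Suc i)\<close> passes at least one zero of \<open>V\<close>;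
counting from the left gives \<open>w i \<le> c i\<close>, counting from the right gives \<open>c i \<le> w (Suc i)\<close>.
Equality would put two of them into the same closed cell.\<close>

lemma interlaced_critical:
  assumes z: "lists_zeros a R D U m z" and w: "lists_zeros a R D V m w"
  shows "\<exists>c. crit = c ` {..<m} \<and> (\<forall>i<m. z i < c i \<and> c i < z (Suc i) \<and> w i < c i \<and> c i < w (Suc i))"
proof -
  have "\<forall>i\<in>{..<m}. \<exists>c. c \<in> crit \<and> z i < c \<and> c < z (Suc i)"
    using critical_in_cell[OF z] by blast
  then obtain c where c: "\<And>i. i < m \<Longrightarrow> c i \<in> crit \<and> z i < c i \<and> c i < z (Suc i)"
    using bchoice[of "{..<m}" "\<lambda>i c. c \<in> crit \<and> z i < c \<and> c < z (Suc i)"] by auto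
  note wf = other.z_facts[OF w]
  have unique: "x = y" if "i < m" "x \<in> crit" "w i \<le> x" "x \<le> w (Suc i)" "y \<in> crit" "w i \<le> y" "y \<le> w (Suc i)" for i x y
    using critical_unique_in_other_cell[OF z w that(1)] that by blast
  have inc: "c i < c (Suc i)" if "Suc i < m" for i
    using c[of i] c[of "Suc i"] that by auto
  have c_D: "c i \<in> D" if "i < m" for i using c[OF that] by (simp add: crit_def)
  have lower: "w i \<le> c i" if "i < m" for i
    using that
  proof (induction i)
    case 0
    then show ?case using wf(5)[OF c_D[OF 0]] by simp
  next
    case (Suc i)
    show ?case
    proof (rule ccontr)
      assume "\<not> w (Suc i) \<le> c (Suc i)"
      then have "c i = c (Suc i)" 
        using Suc inc[of i] c[of i] c[of "Suc i"] by (intro unique[of i]) auto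
      then show False using inc[of i] Suc by simp
    qed
  qed
  have upper: "c (m - Suc j) \<le> w (m - j)" if "j < m" for j
    using that
  proof (induction j)
    case 0
    then show ?case using wf(2) D_bounds(2)[OF c_D[of "m - 1"]] by auto
  next
    case (Suc j)
    define i where "i = m - Suc (Suc j)"
    have i: "Suc i < m" "m - Suc j = Suc i" "m - j = Suc (Suc i)" using Suc.prems by (auto simp: i_def)
    have IH: "c (Suc i) \<le> w (Suc (Suc i))" using Suc i by simp
    have "c i \<le> w (Suc i)"
    proof (rule ccontr)
      assume "\<not> c i \<le> w (Suc i)"
      then have "c i = c (Suc i)" 
        using IH i inc[of i] c[of i] c[of "Suc i"] by (intro unique[of "Suc i"]) auto
      then show False using inc[of i] i by simp
    qed
    then show ?case using i by (simp add: i_def)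
  qed
  have upper': "c i \<le> w (Suc i)" if "i < m" for i
    using upper[of "m - Suc i"] that by (simp add: Suc_diff_Suc)
  have "w i < c i" if "i < m" for i
  proof (rule ccontr)
    assume "\<not> w i < c i"
    then have eq: "c i = w i" using lower[OF that] by simp
    show False
    proof (cases i)
      case 0
      then show False using eq c_D[OF that] wf(4) by simp
    next
      case (Suc j)
      then have "c j = c i" using eq that c[of j] c[of i] lower[of j] upper'[of j] wf(3)[of j "Suc j"]
        by (intro unique[of j]) auto
      then show False using inc[of j] Suc that by simp
    qed
  qed
  moreover have "c i < w (Suc i)" if "i < m" for i
  proof (rule ccontr)
    assume "\<not> c i < w (Suc i)"
    then have eq: "c i = w (Suc i)" using upper'[OF that] by simp
    show False
    proof (cases "Suc i = m")
      case True
      then show False using eq c_D[OF that] wf(2) D_bounds(2)[of "c i"] by simp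
    next
      case False
      then have "Suc i < m" using that by simp
      then have "c i = c (Suc i)"
        using eq c[of i] c[of "Suc i"] lower[of "Suc i"] upper'[of "Suc i"] wf(3)[of "Suc i" "Suc (Suc i)"]
        by (intro unique[of "Suc i"]) auto
      then show False using inc[of i] \<open>Suc i < m\<close> by simp
    qed
  qed
  moreover have "crit = c ` {..<m}"
  proof (intro equalityI subsetI)
    fix x assume x: "x \<in> crit"
    then have "w 0 \<le> x" "x < w m" using wf(2) wf(5)[of x] D_bounds(2)[of x] by (auto simp: crit_def)
    then obtain i where i: "i < m" "w i \<le> x" "x < w (Suc i)" using cell_exists by blast
    then have "x = c i" using x c[of i] lower[of i] upper'[of i] by (intro unique[of i]) auto
    then show "x \<in> c ` {..<m}" using i by simp
  qed (use c in auto)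
  ultimately show ?thesis using c by blast
qed

text \<open>The \<open>m\<close> alternating points of \<open>V\<close> are moved to critical points of \<open>V\<close>. Critical points in one cell
of \<open>U\<close> have the same value of \<open>V\<close>, so the \<open>m\<close> of them are distributed one to each cell. The point is
that \<open>V\<close> does not vanish at them.\<close>

lemma other_critical_in_cells:
  assumes z: "lists_zeros a R D U m z"
  shows "\<exists>d. \<forall>i<m. d i \<in> other.crit \<and> z i \<le> d i \<and> d i < z (Suc i) \<and> V (d i) \<noteq> 0"
proof -
  interpret flip: radial_system a R D k V V' G U U' F by (rule flip)
  obtain s where s: "alternates D V m s R" using other_alternates[OF z] by blast
  then have alt: "alternates other.crit V m s (z m)"
    using other.alternates_critical[OF s] a_less_R other.right z_facts(2)[OF z] by simp
  have cell: "0 \<le> V x * V y" if "i < m" "x \<in> other.crit" "y \<in> other.crit" "z i \<le> x" "x < z (Suc i)"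
    "z i \<le> y" "y < z (Suc i)" for i x y
  proof -
    have "V x = V y"
      using flip.flat_in_other_cell[OF z that(1), of x y y] flip.flat_in_other_cell[OF z that(1), of y x x] that
      by (cases "x \<le> y") auto
    then show ?thesis by simp
  qed
  have base: "z 0 \<le> x" if "x \<in> other.crit" for x
    using z_facts(5)[OF z, of x] that by (auto simp: other.crit_def)
  have "\<exists>d\<in>other.crit. z i \<le> d \<and> d < z (Suc i) \<and> 0 < s * (- 1) ^ (m - Suc i) * V d" if "i < m" for i
    by (rule alternates_cells_eq[OF base _ alt that]) (assumption, rule cell)
  then have "\<forall>i\<in>{..<m}. \<exists>d. d \<in> other.crit \<and> z i \<le> d \<and> d < z (Suc i) \<and> V d \<noteq> 0" by force
  then show ?thesis
    using bchoice[of "{..<m}" "\<lambda>i d. d \<in> other.crit \<and> z i \<le> d \<and> d < z (Suc i) \<and> V d \<noteq> 0"] by auto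
qed

text \<open>In a cell of \<open>U\<close> with its critical point \<open>d\<close> of nonzero value, at most one zero of \<open>V\<close> lies on each
side of \<open>d\<close>: between two zeros there is another critical point \<open>e\<close>, and \<open>V\<close> would be constant between
\<open>d\<close> and \<open>e\<close>, hence nonzero at the zero that lies there.\<close>

lemma other_zeros_finite:
  assumes z: "lists_zeros a R D U m z"
  shows "finite {r \<in> D. V r = 0}" and "a \<in> D \<Longrightarrow> V a \<noteq> 0"
proof -
  interpret flip: radial_system a R D k V V' G U U' F by (rule flip)
  obtain d where d: "\<And>i. i < m \<Longrightarrow> d i \<in> other.crit \<and> z i \<le> d i \<and> d i < z (Suc i) \<and> V (d i) \<noteq> 0"
    using other_critical_in_cells[OF z] by blast
  have finite_sub: "finite S" if "\<And>x y. x \<in> S \<Longrightarrow> y \<in> S \<Longrightarrow> x < y \<Longrightarrow> False" for S :: "real set"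
  proof (cases "S = {}")
    case False
    then obtain x where "x \<in> S" by blast
    have "y = x" if "y \<in> S" for y
      using \<open>\<And>x y. x \<in> S \<Longrightarrow> y \<in> S \<Longrightarrow> x < y \<Longrightarrow> False\<close>[of x y]
        \<open>\<And>x y. x \<in> S \<Longrightarrow> y \<in> S \<Longrightarrow> x < y \<Longrightarrow> False\<close>[of y x] \<open>x \<in> S\<close> that by (cases y x rule: linorder_cases) auto
    then have "S \<subseteq> {x}" by blast
    then show ?thesis using finite_subset by blast
  qed simp
  \<comment> \<open>The zeros in the \<open>i\<close>-th cell to the left and to the right of \<open>d i\<close>.\<close>
  define A where "A i = {r \<in> D. V r = 0 \<and> z i \<le> r \<and> r \<le> d i}" for i
  define B where "B i = {r \<in> D. V r = 0 \<and> d i \<le> r \<and> r < z (Suc i)}" for i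
  have "finite (A i)" if "i < m" for i
  proof (rule finite_sub)
    fix x y assume xy: "x \<in> A i" "y \<in> A i" "x < y"
    then obtain e where e: "e \<in> other.crit" "x < e" "e < y"
      using other.Rolle_critical[of x y] by (auto simp: A_def)
    have di: "d i \<in> other.crit" "d i \<le> z (Suc i)" "V (d i) \<noteq> 0" and y: "V y = 0" "y \<le> d i" "z i \<le> e"
      using d[OF that] xy e by (auto simp: A_def)
    have "V y = V e" "V (d i) = V e"
      using flip.flat_in_other_cell[OF z that e(1) y(3) di(1,2), of y]
        flip.flat_in_other_cell[OF z that e(1) y(3) di(1,2), of "d i"] y(2) e(3) by simp_all
    then show False using y di by simp
  qed
  moreover have "finite (B i)" if "i < m" for i
  proof (rule finite_sub)
    fix x y assume xy: "x \<in> B i" "y \<in> B i" "x < y"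
    then obtain e where e: "e \<in> other.crit" "x < e" "e < y"
      using other.Rolle_critical[of x y] by (auto simp: B_def)
    have di: "d i \<in> other.crit" "z i \<le> d i" "V (d i) \<noteq> 0" and x: "V x = 0" "d i \<le> x" "e \<le> z (Suc i)"
      using d[OF that] xy e by (auto simp: B_def)
    have "V x = V (d i)"
      using flip.flat_in_other_cell[OF z that di(1,2) e(1) x(3), of x] x(2) e(2) by simp
    then show False using x di by simp
  qed
  ultimately have "finite (\<Union>i<m. A i \<union> B i)" by auto
  moreover have "{r \<in> D. V r = 0} \<subseteq> (\<Union>i<m. A i \<union> B i)"
  proof
    fix r assume r: "r \<in> {r \<in> D. V r = 0}"
    then have "z 0 \<le> r" "r < z m" using z_facts(2,5)[OF z] D_bounds(2)[of r] by (auto simp: less_imp_le)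
    then obtain i where "i < m" "z i \<le> r" "r < z (Suc i)" using cell_exists by blast
    then show "r \<in> (\<Union>i<m. A i \<union> B i)" using r by (auto simp: A_def B_def)
  qed
  ultimately show "finite {r \<in> D. V r = 0}" by (rule finite_subset[rotated])
  assume aD: "a \<in> D"
  then have "a \<in> other.crit" using other.left by (intro other.critI) auto
  moreover have m: "0 < m" using z_facts(1)[OF z] by simp
  moreover have "a \<le> d 0" using d[OF m] D_bounds(1)[of "d 0"] by (auto simp: other.crit_def)
  ultimately have "V (d 0) = V a"
    using flip.flat_in_other_cell[OF z m, of a "d 0" "d 0"] d[OF m] z_facts(6)[OF z] by auto
  then show "V a \<noteq> 0" using d[OF m] by simp
qed

text \<open>\<open>V\<close> has its own number \<open>n\<close> of cells. Alternating points of \<open>V\<close> obtained from the cells of \<open>U\<close> give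
\<open>m \<le> n\<close>, and the exchanged argument gives \<open>n \<le> m\<close>.\<close>

lemma other_lists_zeros:
  assumes z: "lists_zeros a R D U m z"
  shows "\<exists>w. lists_zeros a R D V m w"
proof -
  interpret flip: radial_system a R D k V V' G U U' F by (rule flip)
  obtain w where w: "lists_zeros a R D V (Suc (card {r \<in> D. V r = 0})) w"
    using lists_zeros_exists[OF other_zeros_finite(1)[OF z] a_less_R _ other_zeros_finite(2)[OF z]] left by auto
  define n where "n = Suc (card {r \<in> D. V r = 0})"
  note w = w[folded n_def]
  obtain s where "alternates D V m s R" using other_alternates[OF z] by blast
  then have "m \<le> n" by (rule other.alternates_le_cells[OF w])
  obtain s' where "alternates D U n s' R" using other.other_alternates[OF w] by blast
  then have "n \<le> m" by (rule alternates_le_cells[OF z])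
  with \<open>m \<le> n\<close> have "n = m" by (rule antisym[rotated])
  then show ?thesis using w by blast
qed

lemma common_signs:
  assumes z: "lists_zeros a R D U m z" and w: "lists_zeros a R D V m w"
  shows "\<exists>s. \<forall>i<m. (\<forall>x\<in>D. z i < x \<longrightarrow> x < z (Suc i) \<longrightarrow> 0 < s i * U x) \<and>
    (\<forall>x\<in>D. w i < x \<longrightarrow> x < w (Suc i) \<longrightarrow> 0 < s i * V x)"
proof -
  obtain s where V: "alternates D V m s R" using other_alternates[OF z] by blast
  then have U: "alternates D U m s R" by (rule other.alternates_transfer)
  show ?thesis
    using sign_on_cell[OF z U] other.sign_on_cell[OF w V]
    by (intro exI[of _ "\<lambda>i. s * (- 1) ^ (m - Suc i)"]) blast
qed

text \<open>Beyond the last critical point (before the first one) the flux is monotone and moves away from \<open>0\<close>, so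
\<open>U'\<close> stays away from \<open>0\<close> up to the boundary.\<close>

lemma boundary_not_critical:
  assumes z: "lists_zeros a R D U m z" and w: "lists_zeros a R D V m w"
    and e: "e \<in> {a, R}" "e \<notin> D"
  shows "\<not> (U has_real_derivative 0) (at e within {a..R})"
proof -
  obtain c where c: "crit = c ` {..<m}"
    "\<And>i. i < m \<Longrightarrow> z i < c i \<and> c i < z (Suc i) \<and> w i < c i \<and> c i < w (Suc i)"
    using interlaced_critical[OF z w] by blast
  note wf = other.z_facts[OF w]
  have m: "0 < m" "Suc (m - 1) = m" using wf(1) by auto
  have R: "0 < R" using a_nonneg a_less_R by simp
  have bound: "t / R ^ k \<le> s * U' r" if "a < r" "r < R" "0 \<le> t" "t \<le> s * flux r" for s t r
  proof -
    have "0 < r ^ k" "r ^ k \<le> R ^ k" using that a_nonneg by (auto intro!: power_mono)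
    then have "t / R ^ k \<le> t / r ^ k" using that by (intro divide_left_mono mult_pos_pos) auto
    also have "\<dots> \<le> s * U' r" using that \<open>0 < r ^ k\<close> by (simp add: flux_def field_simps)
    finally show ?thesis .
  qed
  have c_D: "c i \<in> D" if "i < m" for i using c(1) that by (auto simp: crit_def)
  consider "e = R" | "e = a" "a \<notin> D" using e by auto
  then show ?thesis
  proof cases
    case 1
    \<comment> \<open>The last critical point and an auxiliary radius beyond it, from which on the flux is bounded away from \<open>0\<close>.\<close>
    define b x where "b = c (m - 1)" and "x = (b + R) / 2"
    have b: "b \<in> D" "b < R" "a \<le> b" "w (m - 1) < b" "flux b = 0"
      using c_D[of "m - 1"] D_bounds[of b] c(2)[of "m - 1"] m c(1) flux_zero_iff[of b]
      by (auto simp: b_def crit_def)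
    have x: "b < x" "x < R" "x \<in> D" using b D_between[of b x] by (auto simp: x_def)
    have "x \<notin> crit"
    proof
      assume "x \<in> crit"
      then obtain i where i: "i < m" "x = c i" using c(1) by auto
      have "i \<noteq> m - 1" using i x by (auto simp: b_def)
      then have "w (Suc i) \<le> w (m - 1)" using i by (intro other.z_mono[OF w]) auto
      then show False using c(2)[of i] i b x by simp
    qed
    then have fx: "flux x \<noteq> 0" using x flux_zero_iff by (simp add: crit_def)
    have V: "0 < V x * V r" if "b < r" "r < R" for r
      using other.open_cell_same_sign[OF w, of "m - 1" x r] that b x m wf(2) D_between[of b r] by auto
    have mono: "V x * flux r' \<le> V x * flux r" if "b \<le> r" "r \<le> r'" "r' < R" for r r'
    proof -
      have "r \<in> D" "r' \<in> D" using that D_between[OF b(1)] by auto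
      then have "- V x * flux r \<le> - V x * flux r'"
        using that V by (intro flux_mono) (auto intro: less_imp_le)
      then show ?thesis by simp
    qed
    have "V x * flux x \<noteq> 0" using V[of x] x fx by auto
    moreover have "V x * flux x \<le> 0" using mono[of b x] b x by simp
    ultimately have pos: "0 < - V x * flux x" by linarith
    show ?thesis
    proof (rule derivative_bounded_away[of x R U U' "- V x * flux x / R ^ k" "- V x"])
      show "continuous_on {x..R} U" using x b by (intro continuous_on_subset[OF cont]) auto
      show "(U has_real_derivative U' r) (at r)" if "x < r" "r < R" for r
        using that x b by (intro deriv_interior) auto
      show "- V x * flux x / R ^ k \<le> - V x * U' r" if "x < r" "r < R" for r
        using that x b pos mono[of x r] by (intro bound) auto
      show "0 < - V x * flux x / R ^ k" using pos R by (intro divide_pos_pos) auto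
    qed (use 1 x b in auto)
  next
    case 2
    define b x where "b = c 0" and "x = (a + b) / 2"
    have "b \<in> crit" using c(1) m(1) by (auto simp: b_def)
    then have b: "b \<in> D" "b < R" "flux b = 0" "b < w 1"
      using flux_zero_iff[of b] D_bounds(2)[of b] c(2)[OF m(1)] by (simp_all add: crit_def b_def)
    have "a \<noteq> b" using b(1) 2(2) by auto
    then have "a < b" using D_bounds(1)[OF b(1)] by simp
    note b = b this
    have x: "a < x" "x < b" "x \<in> D" using b D_bounds(3)[of x] by (auto simp: x_def)
    have "x \<notin> crit"
    proof
      assume "x \<in> crit"
      then obtain i where i: "i < m" "x = c i" using c(1) by auto
      have "i \<noteq> 0" using i(2) x(2) unfolding b_def by (metis less_irrefl)
      then have "w 1 \<le> w i" using i by (intro other.z_mono[OF w]) auto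
      then show False using c(2)[of i] i b x by simp
    qed
    then have fx: "flux x \<noteq> 0" using x flux_zero_iff by (simp add: crit_def)
    have V: "0 < V x * V r" if "a < r" "r < b" for r
      using other.open_cell_same_sign[OF w m(1), of x r] that b x wf(5)[of r] wf(5)[of x] D_bounds(3)[of r] by auto
    have mono: "V x * flux r' \<le> V x * flux r" if "a < r" "r \<le> r'" "r' \<le> b" for r r'
    proof -
      have "r \<in> D" "r' \<in> D" using that b D_bounds(3) by auto
      then have "- V x * flux r \<le> - V x * flux r'"
        using that V by (intro flux_mono) (auto intro: less_imp_le)
      then show ?thesis by simp
    qed
    have "V x * flux x \<noteq> 0" using V[of x] x fx by auto
    moreover have "0 \<le> V x * flux x" using mono[of x b] b x by simp
    ultimately have pos: "0 < V x * flux x" by linarith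
    show ?thesis
    proof (rule derivative_bounded_away[of a x U U' "V x * flux x / R ^ k" "V x"])
      show "continuous_on {a..x} U" using x b by (intro continuous_on_subset[OF cont]) auto
      show "(U has_real_derivative U' r) (at r)" if "a < r" "r < x" for r
        using that x b by (intro deriv_interior) auto
      show "V x * flux x / R ^ k \<le> V x * U' r" if "a < r" "r < x" for r
        using that x b pos mono[of r x] by (intro bound) auto
      show "0 < V x * flux x / R ^ k" using pos R by (intro divide_pos_pos) auto
    qed (use 2 x b in auto)
  qed
qed

end

section \<open>Components of a punctured interval\<close>

lemma components_cells:
  fixes z :: "nat \<Rightarrow> real"
  assumes T: "is_interval T" and z: "\<And>i j. i < j \<Longrightarrow> j \<le> m \<Longrightarrow> z i < z j"
    and ne: "\<And>i. i < m \<Longrightarrow> T \<inter> {z i<..<z (Suc i)} \<noteq> {}"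
  shows "components (\<Union>i<m. T \<inter> {z i<..<z (Suc i)}) = (\<lambda>i. T \<inter> {z i<..<z (Suc i)}) ` {..<m}" (is "components ?S = ?C ` _")
    and "inj_on (\<lambda>i. T \<inter> {z i<..<z (Suc i)}) {..<m}"
proof -
  have z_le: "z i \<le> z j" if "i \<le> j" "j \<le> m" for i j
    using z[of i j] that by (cases "i = j") auto
  have not_in: "z j \<notin> ?S" if "j \<le> m" for j
  proof
    assume "z j \<in> ?S"
    then obtain i where i: "i < m" "z i < z j" "z j < z (Suc i)" by auto
    then have "\<not> j \<le> i" "\<not> Suc i \<le> j" using z_le[of j i] z_le[of "Suc i" j] that by auto
    then show False by simp
  qed
  have comp: "connected_component_set ?S x = ?C i" if "i < m" "x \<in> ?C i" for i x
  proof (rule connected_component_unique)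
    show "connected (?C i)"
      using T by (intro is_interval_connected is_interval_Int) (auto simp: is_interval_oo)
    fix c assume c: "x \<in> c" "c \<subseteq> ?S" "connected c"
    then have int: "is_interval c" using is_interval_connected_1 by blast
    show "c \<subseteq> ?C i"
    proof
      fix y assume y: "y \<in> c"
      have "y \<in> T" using y c by auto
      moreover have "y < z (Suc i)"
      proof (rule ccontr)
        assume "\<not> y < z (Suc i)"
        then have "z (Suc i) \<in> c"
          using mem_is_interval_1_I[OF int, of x y "z (Suc i)"] c y that by auto
        then have "z (Suc i) \<in> ?S" using c by (metis subsetD)
        then show False using not_in[of "Suc i"] that(1) by simp
      qed
      moreover have "z i < y"
      proof (rule ccontr)
        assume "\<not> z i < y"
        then have "z i \<in> c"
          using mem_is_interval_1_I[OF int, of y x "z i"] c y that by auto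
        then have "z i \<in> ?S" using c by (metis subsetD)
        then show False using not_in[of i] that(1) by simp
      qed
      ultimately show "y \<in> ?C i" by simp
    qed
  qed (use that in auto)
  show "components ?S = ?C ` {..<m}"
  proof (intro equalityI subsetI)
    fix c assume "c \<in> components ?S"
    then obtain x where x: "x \<in> ?S" "c = connected_component_set ?S x" by (rule componentsE)
    then obtain i where "i < m" "x \<in> ?C i" by blast
    then show "c \<in> ?C ` {..<m}" using comp[of i x] x by auto
  next
    fix c assume "c \<in> ?C ` {..<m}"
    then obtain i where i: "i < m" "c = ?C i" by auto
    then obtain x where x: "x \<in> ?C i" using ne by blast
    then have "c = connected_component_set ?S x" using comp[of i x] i by simp
    moreover have "x \<in> ?S" using x i by blast
    ultimately show "c \<in> components ?S" unfolding components_def by (rule image_eqI)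
  qed
  have less: "?C i \<noteq> ?C j" if ij: "i < j" "j < m" for i j
  proof
    assume eq: "?C i = ?C j"
    have "i < m" using ij by simp
    then obtain x where "x \<in> ?C i" using ne[of i] by blast
    then have "x < z (Suc i)" "z j < x" using eq by auto
    then show False using z_le[of "Suc i" j] that by simp
  qed
  show "inj_on ?C {..<m}"
  proof (rule inj_onI)
    fix i j assume "i \<in> {..<m}" "j \<in> {..<m}" "?C i = ?C j"
    then show "i = j" using less[of i j] less[of j i] by (cases i j rule: linorder_cases) auto
  qed
qed

section \<open>Radial functions\<close>

lemma partial_deriv_line:
  assumes "f differentiable at (x + t *\<^sub>R c)"
  shows "((\<lambda>t. f (x + t *\<^sub>R c)) has_real_derivative partial_deriv c f (x + t *\<^sub>R c)) (at t)"
proof -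
  let ?f' = "frechet_derivative f (at (x + t *\<^sub>R c))"
  have "(f has_derivative ?f') (at (x + t *\<^sub>R c))" using assms frechet_derivative_works by blast
  moreover have "((\<lambda>t. x + t *\<^sub>R c) has_derivative (\<lambda>h. h *\<^sub>R c)) (at t)"
    by (auto intro!: derivative_eq_intros)
  ultimately have "((\<lambda>t. f (x + t *\<^sub>R c)) has_derivative (\<lambda>h. ?f' (h *\<^sub>R c))) (at t)"
    using has_derivative_compose by blast
  moreover have "(\<lambda>h. ?f' (h *\<^sub>R c)) = (*) (partial_deriv c f (x + t *\<^sub>R c))"
    using linear_scale[OF linear_frechet_derivative[OF assms]]
    by (auto simp: partial_deriv_def mult.commute)
  ultimately show ?thesis by (simp add: has_field_derivative_def)
qed

text \<open>\<open>D\<close> is the set of radii of \<open>\<Omega>\<close>; in a ball it contains its left end, the origin.\<close>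

locale radial_domain =
  fixes \<Omega> :: "'a::euclidean_space set" and a R :: real and D :: "real set"
  assumes less: "a < R" and domain: "\<Omega> = {x. norm x \<in> D}"
    and shape: "0 < a \<and> D = {a<..<R} \<or> a = 0 \<and> D = {a..<R}"
begin

lemma a_nonneg: "0 \<le> a" using shape by auto

lemma D_iff_interior: "a < r \<Longrightarrow> r \<in> D \<longleftrightarrow> r < R" using shape by auto

lemma D_bounds: "r \<in> D \<Longrightarrow> a \<le> r" "r \<in> D \<Longrightarrow> r < R" using shape by auto

lemma open_domain: "open \<Omega>"
  using shape
proof
  assume "0 < a \<and> D = {a<..<R}"
  then have "\<Omega> = {x. a < norm x} \<inter> {x. norm x < R}" using domain by auto
  then show ?thesis by (auto intro!: open_Int open_Collect_less continuous_intros)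
next
  assume "a = 0 \<and> D = {a..<R}"
  then have "\<Omega> = {x. norm x < R}" using domain by auto
  then show ?thesis by (auto intro!: open_Collect_less continuous_intros)
qed

lemma closure_domain: "closure \<Omega> = {x. norm x \<in> {a..R}}"
proof (rule antisym)
  have "closed {x::'a. norm x \<in> {a..R}}"
    by (auto intro!: closed_Collect_conj closed_Collect_le continuous_intros)
  then show "closure \<Omega> \<subseteq> {x. norm x \<in> {a..R}}"
    by (rule closure_minimal[rotated]) (use domain shape in auto)
  show "{x. norm x \<in> {a..R}} \<subseteq> closure \<Omega>"
  proof
    fix x :: 'a assume x: "x \<in> {x. norm x \<in> {a..R}}"
    obtain e :: 'a where e: "norm e = 1" "x = norm x *\<^sub>R e"
    proof (cases "x = 0")
      case True
      obtain b :: 'a where "b \<in> Basis" using nonempty_Basis by blast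
      then show ?thesis using that[of b] True by simp
    next
      case False
      then show ?thesis using that[of "sgn x"] by (simp add: norm_sgn sgn_div_norm)
    qed
    have "closure D = {a..R}" using shape less by auto
    have "(\<lambda>r. r *\<^sub>R e) ` closure D \<subseteq> closure ((\<lambda>r. r *\<^sub>R e) ` D)"
      by (rule continuous_image_closure_subset[of UNIV]) (auto intro!: continuous_intros)
    also have "\<dots> \<subseteq> closure \<Omega>"
      using e D_bounds(1) a_nonneg by (intro closure_mono) (fastforce simp: domain)
    finally have "(\<lambda>r. r *\<^sub>R e) ` {a..R} \<subseteq> closure \<Omega>" by (simp add: \<open>closure D = {a..R}\<close>)
    moreover have "norm x *\<^sub>R e \<in> (\<lambda>r. r *\<^sub>R e) ` {a..R}" using x by blast
    ultimately have "norm x *\<^sub>R e \<in> closure \<Omega>" by blast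
    then show "x \<in> closure \<Omega>" using e(2) by simp
  qed
qed

lemma norm_image_domain: "norm ` \<Omega> = D"
proof -
  obtain b :: 'a where b: "b \<in> Basis" using nonempty_Basis by blast
  have "r \<in> norm ` \<Omega>" if "r \<in> D" for r
    using that b D_bounds(1)[OF that] a_nonneg by (intro image_eqI[of _ _ "r *\<^sub>R b"]) (auto simp: domain)
  then show ?thesis by (auto simp: domain)
qed

lemma norm_image_closure: "norm ` closure \<Omega> = {a..R}"
proof -
  obtain b :: 'a where b: "b \<in> Basis" using nonempty_Basis by blast
  have "r \<in> norm ` closure \<Omega>" if "r \<in> {a..R}" for r
    using that b a_nonneg by (intro image_eqI[of _ _ "r *\<^sub>R b"]) (auto simp: closure_domain)
  then show ?thesis by (auto simp: closure_domain)
qed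

lemma frontier_domain: "norm x \<in> {a..R} \<Longrightarrow> norm x \<notin> D \<Longrightarrow> x \<in> frontier \<Omega>"
  using open_domain closure_domain domain by (simp add: frontier_def interior_open)

lemma centered_ball_imp: "centered_ball \<Omega> \<Longrightarrow> a = 0 \<and> a \<in> D"
proof -
  assume "centered_ball \<Omega>"
  then have "0 \<in> \<Omega>" by (auto simp: centered_ball_def)
  then have "0 \<in> D" by (simp add: domain)
  then show ?thesis using shape by auto
qed

end

lemma radial_domain_exists:
  assumes "centered_ball \<Omega> \<or> spherical_shell \<Omega>"
  shows "\<exists>a R D. radial_domain \<Omega> a R D"
  using assms
proof
  assume "centered_ball \<Omega>"
  then obtain R where "0 < R" "\<Omega> = {x. norm x < R}" by (auto simp: centered_ball_def)
  then have "radial_domain \<Omega> 0 R {0..<R}" by unfold_locales auto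
  then show ?thesis by blast
next
  assume "spherical_shell \<Omega>"
  then obtain a R where "0 < a" "a < R" "\<Omega> = {x. a < norm x \<and> norm x < R}"
    by (auto simp: spherical_shell_def)
  then have "radial_domain \<Omega> a R {a<..<R}" by unfold_locales auto
  then show ?thesis by blast
qed

text \<open>The unit vector \<open>b\<close> selects a ray, along which the derivatives of the profile are partial derivatives
of \<open>u\<close>.\<close>

locale radial_function = radial_domain \<Omega> a R D
  for \<Omega> :: "'a::euclidean_space set" and a R :: real and D :: "real set" +
  fixes u :: "'a \<Rightarrow> real" and U :: "real \<Rightarrow> real" and b :: 'a
  assumes b: "b \<in> Basis" and C2: "C2_on \<Omega> u" and profile: "radial_profile \<Omega> u U"
    and cont_closure: "continuous_on (closure \<Omega>) u"
begin

definition U' :: "real \<Rightarrow> real" where "U' r = partial_deriv b u (r *\<^sub>R b)"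
definition U'' :: "real \<Rightarrow> real" where "U'' r = partial_deriv b (partial_deriv b u) (r *\<^sub>R b)"

lemma on_ray: "r \<in> D \<Longrightarrow> r *\<^sub>R b \<in> \<Omega>"
  using b D_bounds(1)[of r] a_nonneg by (simp add: domain)

lemma u_radial: "x \<in> closure \<Omega> \<Longrightarrow> u x = U (norm x)"
  using profile by (simp add: radial_profile_def)

lemma u_radial': "x \<in> \<Omega> \<Longrightarrow> u x = U (norm x)"
  using u_radial closure_subset by blast

lemma profile_on_ray: "r \<in> {a..R} \<Longrightarrow> U r = u (r *\<^sub>R b)"
  using u_radial[of "r *\<^sub>R b"] b a_nonneg by (simp add: closure_domain)

lemma profile_continuous: "continuous_on {a..R} U"
proof -
  have "continuous_on {a..R} (\<lambda>r. u (r *\<^sub>R b))"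
    using b a_nonneg by (intro continuous_on_compose2[OF cont_closure]) (auto intro!: continuous_intros simp: closure_domain)
  then show ?thesis by (rule continuous_on_eq) (use profile_on_ray in auto)
qed

lemma u_differentiable: "x \<in> \<Omega> \<Longrightarrow> u differentiable at x"
  using C2 by (simp add: C2_on_def)

lemma partial_differentiable: "x \<in> \<Omega> \<Longrightarrow> c \<in> Basis \<Longrightarrow> partial_deriv c u differentiable at x"
  using C2 by (simp add: C2_on_def)

lemma deriv_on_ray: "r \<in> D \<Longrightarrow> ((\<lambda>r. u (r *\<^sub>R b)) has_real_derivative U' r) (at r)"
  using partial_deriv_line[of u 0 r b] u_differentiable[OF on_ray] by (simp add: U'_def)

lemma profile_deriv:
  assumes "r \<in> D"
  shows "(U has_real_derivative U' r) (at r within {a..R})"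
proof (rule has_field_derivative_transform_within[OF has_field_derivative_at_within[OF deriv_on_ray[OF assms]], of 1])
  show "r \<in> {a..R}" using D_bounds[OF assms] by simp
  show "u (x *\<^sub>R b) = U x" if "x \<in> {a..R}" for x using profile_on_ray[OF that] by simp
qed simp

lemma profile_deriv2: "r \<in> D \<Longrightarrow> (U' has_real_derivative U'' r) (at r)"
  using partial_deriv_line[of "partial_deriv b u" 0 r b] partial_differentiable[OF on_ray b]
  unfolding U'_def[abs_def] U''_def by simp

lemma profile_deriv_continuous: "continuous_on D U'"
  using profile_deriv2 by (meson DERIV_continuous_on has_field_derivative_at_within)

text \<open>A radial function is even along the line through the origin.\<close>

lemma profile_deriv_origin:
  assumes "0 \<in> D"
  shows "U' 0 = 0"
proof -
  have a: "a = 0" using shape assms by auto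
  have "((\<lambda>r. u ((- r) *\<^sub>R b)) has_real_derivative - U' 0) (at 0)"
    using DERIV_mirror[of "\<lambda>r. u (r *\<^sub>R b)" "U' 0" 0] deriv_on_ray[OF assms] by simp
  then have "((\<lambda>r. u (r *\<^sub>R b)) has_real_derivative - U' 0) (at 0)"
  proof (rule has_field_derivative_transform_within_open[of _ _ _ "{-R<..<R}"])
    fix r assume "r \<in> {-R<..<R}"
    then have "norm (r *\<^sub>R b) \<in> {a..R}" "norm ((- r) *\<^sub>R b) \<in> {a..R}" using b a by auto
    then show "u ((- r) *\<^sub>R b) = u (r *\<^sub>R b)" using u_radial closure_domain b by simp
  qed (use less a in auto)
  then have "U' 0 = - U' 0" by (rule DERIV_unique[OF deriv_on_ray[OF assms]])
  then show ?thesis by simp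
qed

lemma partial_deriv_radial:
  assumes x: "x \<in> \<Omega>" "x \<noteq> 0"
  shows "partial_deriv c u x = U' (norm x) * (x \<bullet> c) / norm x"
proof -
  have nx: "norm x \<in> D" "a < norm x" "norm x < R" using x shape by (auto simp: domain)
  have "(U has_real_derivative U' (norm x)) (at (norm x))"
    using profile_deriv[OF nx(1)] nx by (simp add: at_within_Icc_at)
  then have "(U has_derivative (*) (U' (norm x))) (at (norm x))" by (simp add: has_field_derivative_def)
  then have "((\<lambda>y. U (norm y)) has_derivative (\<lambda>h. U' (norm x) * (h \<bullet> sgn x))) (at x)"
    using has_derivative_compose[OF has_derivative_norm[OF x(2)]] by blast
  then have "(u has_derivative (\<lambda>h. U' (norm x) * (h \<bullet> sgn x))) (at x)"
    by (rule has_derivative_transform_within_open[OF _ open_domain x(1)]) (simp add: u_radial')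
  then have "frechet_derivative u (at x) = (\<lambda>h. U' (norm x) * (h \<bullet> sgn x))"
    by (rule frechet_derivative_at[symmetric])
  then show ?thesis by (simp add: partial_deriv_def sgn_div_norm inner_commute divide_inverse)
qed

text \<open>Along \<open>\<gamma> h = r b + h c\<close> the partial derivative in direction \<open>c\<close> is \<open>h\<close> times
\<open>U' \<rho> / \<rho>\<close>, where \<open>\<rho> = norm (\<gamma> h)\<close>. As this second factor is continuous, the derivative at
\<open>h = 0\<close> is its value there.\<close>

lemma second_partial_tangential:
  assumes r: "a < r" "r < R" and c: "c \<in> Basis" "c \<noteq> b"
  shows "partial_deriv c (partial_deriv c u) (r *\<^sub>R b) = U' r / r"
proof -
  have rD: "r \<in> D" "0 < r" using r D_iff_interior a_nonneg by auto
  define \<gamma> where "\<gamma> h = r *\<^sub>R b + h *\<^sub>R c" for h :: real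
  define \<phi> where "\<phi> h = U' (norm (\<gamma> h)) / norm (\<gamma> h)" for h
  have \<gamma>0: "\<gamma> 0 = r *\<^sub>R b" "norm (\<gamma> 0) = r" using b rD by (auto simp: \<gamma>_def)
  have inner: "\<gamma> h \<bullet> c = h" for h
    using b c by (simp add: \<gamma>_def inner_left_distrib inner_Basis)
  have \<gamma>_cont: "isCont (\<lambda>h. norm (\<gamma> h)) 0" unfolding \<gamma>_def by (intro continuous_intros)
  have "isCont U' r" using profile_deriv2[OF rD(1)] by (rule DERIV_isCont)
  then have "isCont \<phi> 0"
    unfolding \<phi>_def using \<gamma>_cont \<gamma>0 rD by (intro continuous_divide isCont_o2[of 0 "\<lambda>h. norm (\<gamma> h)" U']) auto
  then have "((\<lambda>h. \<phi> h * h) has_real_derivative \<phi> 0) (at 0)"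
    unfolding CARAT_DERIV by (intro exI[of _ \<phi>]) auto
  moreover have "open (\<gamma> -` (\<Omega> - {0}))"
    unfolding \<gamma>_def using open_domain by (intro open_vimage open_Diff) (auto intro!: continuous_intros)
  ultimately have "((\<lambda>h. partial_deriv c u (\<gamma> h)) has_real_derivative \<phi> 0) (at 0)"
  proof (rule has_field_derivative_transform_within_open)
    show "0 \<in> \<gamma> -` (\<Omega> - {0})" using \<gamma>0 on_ray[OF rD(1)] rD b by auto
    fix h assume "h \<in> \<gamma> -` (\<Omega> - {0})"
    then show "\<phi> h * h = partial_deriv c u (\<gamma> h)"
      using partial_deriv_radial[of "\<gamma> h" c] by (simp add: \<phi>_def inner)
  qed
  moreover have "((\<lambda>h. partial_deriv c u (\<gamma> h)) has_real_derivative
      partial_deriv c (partial_deriv c u) (r *\<^sub>R b)) (at 0)"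
    using partial_deriv_line[of "partial_deriv c u" "r *\<^sub>R b" 0 c]
      partial_differentiable[OF on_ray[OF rD(1)] c(1)] by (simp add: \<gamma>_def)
  ultimately show ?thesis using DERIV_unique \<gamma>0 by (fastforce simp: \<phi>_def)
qed

lemma laplacian_on_ray:
  assumes r: "a < r" "r < R"
  shows "laplacian u (r *\<^sub>R b) = U'' r + (DIM('a) - 1) * U' r / r"
proof -
  have "laplacian u (r *\<^sub>R b) = U'' r + (\<Sum>c\<in>Basis - {b}. partial_deriv c (partial_deriv c u) (r *\<^sub>R b))"
    unfolding laplacian_def U''_def by (rule sum.remove) (use b in auto)
  also have "(\<Sum>c\<in>Basis - {b}. partial_deriv c (partial_deriv c u) (r *\<^sub>R b)) = (\<Sum>c\<in>Basis - {b}. U' r / r)"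
    by (rule sum.cong) (use second_partial_tangential[OF r] in auto)
  also have "\<dots> = (DIM('a) - 1) * U' r / r" using b by (simp add: card_Diff_singleton)
  finally show ?thesis .
qed

lemma flux_deriv:
  assumes r: "a < r" "r < R"
  shows "((\<lambda>r. r ^ (DIM('a) - 1) * U' r) has_real_derivative
    r ^ (DIM('a) - 1) * laplacian u (r *\<^sub>R b)) (at r)"
proof -
  have rD: "r \<in> D" "0 < r" using r D_iff_interior a_nonneg by auto
  define k where "k = DIM('a) - 1"
  have k: "laplacian u (r *\<^sub>R b) = U'' r + real k * U' r / r"
    unfolding k_def laplacian_on_ray[OF r] by (simp add: of_nat_diff)
  have "((\<lambda>r. r ^ k * U' r) has_real_derivative real k * r ^ (k - 1) * U' r + U'' r * r ^ k) (at r)"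
    using DERIV_mult[OF DERIV_pow[of k r UNIV] profile_deriv2[OF rD(1)]] by simp
  moreover have "real k * r ^ (k - 1) * U' r + U'' r * r ^ k = r ^ k * (U'' r + real k * U' r / r)"
    using rD by (cases k) (auto simp: field_simps)
  ultimately show ?thesis unfolding k_def[symmetric] k by simp
qed

lemma laplacian_continuous_on_ray: "continuous_on D (\<lambda>r. laplacian u (r *\<^sub>R b))"
proof -
  have "continuous_on \<Omega> (laplacian u)"
    unfolding laplacian_def[abs_def] using C2 by (intro continuous_on_sum) (simp add: C2_on_def)
  then show ?thesis by (rule continuous_on_compose2) (use on_ray in \<open>auto intro!: continuous_intros\<close>)
qed

end

section \<open>Where the sign condition holds\<close>

text \<open>The sign condition speaks only of \<open>s \<noteq> 0\<close>, \<open>t \<noteq> 0\<close>. By continuity it holds weakly at all points;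
for \<open>t = 0\<close> both signs of \<open>\<sigma>\<close> are admitted, so there \<open>f\<close> vanishes.\<close>

lemma sign_at_limit:
  fixes f :: "real \<times> real \<Rightarrow> real"
  assumes cont: "continuous_on UNIV f" and pos: "\<And>s t. s \<noteq> 0 \<Longrightarrow> t \<noteq> 0 \<Longrightarrow> 0 < f (s, t) / t"
    and \<sigma>: "0 \<le> \<sigma> * t"
  shows "0 \<le> \<sigma> * f (s, t)"
proof (cases "\<sigma> = 0")
  case False
  \<comment> \<open>Approach \<open>(s, t)\<close> along points whose coordinates are nonzero and whose second coordinate has the sign of \<open>\<sigma>\<close>.\<close>
  have "((\<lambda>h. (s + h, t + \<sigma> * h)) \<longlongrightarrow> (s + 0, t + \<sigma> * 0)) (at_right 0)"
    by (intro tendsto_intros)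
  from continuous_on_tendsto_compose[OF cont this]
  have "((\<lambda>h. \<sigma> * f (s + h, t + \<sigma> * h)) \<longlongrightarrow> \<sigma> * f (s + 0, t + \<sigma> * 0)) (at_right 0)"
    by (intro tendsto_mult tendsto_const) simp
  moreover have "\<forall>\<^sub>F h in at_right 0. 0 \<le> \<sigma> * f (s + h, t + \<sigma> * h)"
  proof -
    have "\<forall>\<^sub>F h in at_right (0::real). 0 < h \<and> h < (if s < 0 then - s else 1)"
      by (intro eventually_conj eventually_at_right_less eventually_at_right_field[THEN iffD2])
         (auto intro!: exI[of _ "if s < 0 then - s else 1"])
    then show ?thesis
    proof eventually_elim
      case (elim h)
      then have "s + h \<noteq> 0" by (auto split: if_splits)
      moreover have "0 < \<sigma> * (\<sigma> * h)"
      proof -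
        have "0 < \<sigma> * \<sigma>" using False by (metis not_real_square_gt_zero)
        then have "0 < (\<sigma> * \<sigma>) * h" using elim by (simp only: zero_less_mult_iff) blast
        then show ?thesis by (simp only: mult.assoc)
      qed
      then have "0 < \<sigma> * (t + \<sigma> * h)" using \<sigma> by (simp add: distrib_left)
      moreover then have "t + \<sigma> * h \<noteq> 0" by auto
      ultimately have "s + h \<noteq> 0" "t + \<sigma> * h \<noteq> 0" "0 < \<sigma> * (t + \<sigma> * h)" by blast+
      then have "0 < f (s + h, t + \<sigma> * h) / (t + \<sigma> * h) * (\<sigma> * (t + \<sigma> * h))"
        using pos by (intro mult_pos_pos[OF _ \<open>0 < \<sigma> * (t + \<sigma> * h)\<close>]) blast
      then show ?case using \<open>t + \<sigma> * h \<noteq> 0\<close> by (simp add: mult.commute)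
    qed
  qed
  ultimately have "0 \<le> \<sigma> * f (s + 0, t + \<sigma> * 0)"
    by (rule tendsto_lowerbound) simp
  then show ?thesis by simp
qed simp

lemma partial_deriv_continuous:
  assumes "C2_on UNIV h" "c \<in> Basis"
  shows "continuous_on UNIV (partial_deriv c h)"
  using assms by (auto simp: C2_on_def intro!: continuous_at_imp_continuous_on differentiable_imp_continuous_within)

context radial_domain
begin

text \<open>A property of almost every point of \<open>\<Omega>\<close> that depends on the radius only holds on a dense set of radii,
as no nonempty open annulus is negligible.\<close>

lemma good_radius:
  assumes AE: "AE x\<in>\<Omega> in lebesgue. P (norm x)" and xy: "a \<le> x" "x < y" "y \<le> R"
  shows "\<exists>r>x. r < y \<and> P r"
proof (rule ccontr)
  assume bad: "\<not> ?thesis"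
  let ?A = "{p::'a. x < norm p} \<inter> {p. norm p < y}"
  from AE obtain N where N: "negligible N" "{p. \<not> (p \<in> \<Omega> \<longrightarrow> P (norm p))} \<subseteq> N"
    unfolding eventually_ae_filter_negligible by blast
  have "?A \<subseteq> N" using bad N(2) xy shape by (fastforce simp: domain)
  then have "negligible ?A" using N(1) negligible_subset by blast
  moreover have "open ?A" by (intro open_Int open_Collect_less continuous_intros)
  moreover have "?A \<noteq> {}"
  proof -
    obtain b :: 'a where "b \<in> Basis" using nonempty_Basis by blast
    then have "((x + y) / 2) *\<^sub>R b \<in> ?A" using xy a_nonneg by auto
    then show ?thesis by blast
  qed
  ultimately show False using open_not_negligible by blast
qed

end

section \<open>From the elliptic system to the radial equations\<close>

text \<open>It is enough that the sign relations between \<open>f\<close> and \<open>V\<close> hold at a dense set of radii: \<open>f\<close> equals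
\<open>- \<Delta>u\<close> along the ray and so is continuous, although \<open>H\<close> itself need not have derivatives that
are continuous in \<open>r\<close>.\<close>

lemma (in radial_function) profile_flux_equation:
  assumes boundary: "\<And>x. x \<in> frontier \<Omega> \<Longrightarrow> u x = 0"
    and equation: "\<And>r. a < r \<Longrightarrow> r < R \<Longrightarrow> - laplacian u (r *\<^sub>R b) = f r"
    and dense: "\<And>x y. a \<le> x \<Longrightarrow> x < y \<Longrightarrow> y \<le> R \<Longrightarrow>
      \<exists>r>x. r < y \<and> (\<forall>\<sigma>. 0 \<le> \<sigma> * V r \<longrightarrow> 0 \<le> \<sigma> * f r) \<and> (U r \<noteq> 0 \<longrightarrow> V r \<noteq> 0 \<longrightarrow> f r \<noteq> 0)"
  shows "flux_equation a R D (DIM('a) - 1) U U' (\<lambda>r. r ^ (DIM('a) - 1) * f r) V"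
proof
  have zero: "U r = 0" if "r \<in> {a..R}" "r \<notin> D" for r
    using boundary[of "r *\<^sub>R b"] frontier_domain[of "r *\<^sub>R b"] profile_on_ray[of r] that b a_nonneg by auto
  show "D = {a<..<R} \<and> U a = 0 \<or> D = {a..<R} \<and> U' a = 0"
    using shape zero[of a] less profile_deriv_origin by auto
  show "U R = 0" using shape zero[of R] less by auto
  show "((\<lambda>r. r ^ (DIM('a) - 1) * U' r) has_real_derivative - (r ^ (DIM('a) - 1) * f r)) (at r)"
    if "a < r" "r < R" for r
    using flux_deriv[OF that] equation[OF that, symmetric] by simp
  show "0 \<le> s * (r ^ (DIM('a) - 1) * f r)"
    if xy: "a \<le> x" "y \<le> R" and V: "\<And>r. x < r \<Longrightarrow> r < y \<Longrightarrow> 0 \<le> s * V r" and r: "x < r" "r < y" for s x y r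
  proof -
    have "0 \<le> s * f r"
    proof (rule ccontr)
      assume "\<not> 0 \<le> s * f r"
      define g where "g t = s * - laplacian u (t *\<^sub>R b)" for t
      have "continuous_on {a<..<R} g" unfolding g_def
        using D_iff_interior by (intro continuous_intros continuous_on_subset[OF laplacian_continuous_on_ray]) auto
      then have "isCont g r" using r xy by (simp add: continuous_on_eq_continuous_at)
      moreover have "g r < 0" using \<open>\<not> 0 \<le> s * f r\<close> equation[of r] r xy by (simp add: g_def)
      ultimately have "\<forall>\<^sub>F t in at r. g t < 0" by (auto simp: isCont_def intro: order_tendstoD(2))
      then obtain d where d: "0 < d" "\<And>t. t \<noteq> r \<Longrightarrow> dist t r < d \<Longrightarrow> g t < 0"
        unfolding eventually_at by auto
      have "a \<le> max x (r - d)" "max x (r - d) < r" "r \<le> R" using xy r d by auto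
      from dense[OF this] obtain t where t: "max x (r - d) < t" "t < r" "0 \<le> s * V t \<longrightarrow> 0 \<le> s * f t"
        by blast
      then have "0 \<le> s * f t" using V[of t] r by simp
      moreover have "g t < 0" using t by (intro d(2)) (auto simp: dist_real_def)
      moreover have "g t = s * f t" using equation[of t] t r xy by (simp add: g_def)
      ultimately show False by simp
    qed
    moreover have "0 \<le> r ^ (DIM('a) - 1)" using r xy a_nonneg by simp
    ultimately have "0 \<le> r ^ (DIM('a) - 1) * (s * f r)" by (rule mult_nonneg_nonneg[rotated])
    then show ?thesis by (simp add: mult.left_commute)
  qed
  show "\<exists>r>x. r < y \<and> r ^ (DIM('a) - 1) * f r \<noteq> 0"
    if xy: "a \<le> x" "x < y" "y \<le> R" and nz: "\<And>r. x < r \<Longrightarrow> r < y \<Longrightarrow> U r \<noteq> 0 \<and> V r \<noteq> 0" for x y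
  proof -
    obtain r where r: "x < r" "r < y" "U r \<noteq> 0 \<longrightarrow> V r \<noteq> 0 \<longrightarrow> f r \<noteq> 0" using dense[OF xy] by blast
    then have "f r \<noteq> 0" "r \<noteq> 0" using nz[of r] xy a_nonneg by auto
    then show ?thesis using r by auto
  qed
qed (use a_nonneg less profile_continuous profile_deriv profile_deriv_continuous in auto)

section \<open>Nodal zones\<close>

lemma lists_zeros_components:
  assumes z: "lists_zeros a R D W m z" and D: "D = {a<..<R} \<or> D = {a..<R}" and aR: "a < R"
  shows "components {r \<in> D. W r \<noteq> 0} = (\<lambda>i. D \<inter> {z i<..<z (Suc i)}) ` {..<m}"
    and "inj_on (\<lambda>i. D \<inter> {z i<..<z (Suc i)}) {..<m}"
proof -
  have zl: "z i < z j" if "i < j" "j \<le> m" for i j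
    using z that strict_mono_on_atMostD by (auto simp: lists_zeros_def)
  have z_le: "z i \<le> z j" if "i \<le> j" "j \<le> m" for i j
    using zl[of i j] that by (cases "i = j") auto
  have ends: "z m = R" "a < z 1" "z 0 \<notin> D" "z 0 \<le> a" "1 \<le> m" "\<And>x. x \<in> D \<Longrightarrow> z 0 < x"
    using z D by (auto simp: lists_zeros_def split: if_splits)
  have zeros: "{r \<in> D. W r = 0} = z ` {1..<m}" using z by (simp add: lists_zeros_def)
  have T: "is_interval D" using D by (auto simp: is_interval_oo is_interval_co)
  have ne: "D \<inter> {z i<..<z (Suc i)} \<noteq> {}" if "i < m" for i
  proof -
    define x where "x = (max a (z i) + z (Suc i)) / 2"
    have "max a (z i) < z (Suc i)"
    proof (cases "i = 0")
      case False
      then have "z i \<in> D" using zeros that by force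
      then show ?thesis using zl[of i "Suc i"] that D by auto
    qed (use ends in auto)
    then have "max a (z i) < x" "x < z (Suc i)" by (auto simp: x_def)
    moreover have "z (Suc i) \<le> R" using z_le[of "Suc i" m] that ends by simp
    ultimately have "x \<in> D \<inter> {z i<..<z (Suc i)}" using D by auto
    then show ?thesis by blast
  qed
  have "{r \<in> D. W r \<noteq> 0} = (\<Union>i<m. D \<inter> {z i<..<z (Suc i)})"
  proof (intro equalityI subsetI)
    fix r assume r: "r \<in> {r \<in> D. W r \<noteq> 0}"
    then have "z 0 \<le> r" "r < z m" using ends(6)[of r] ends(1) D by auto
    then obtain i where i: "i < m" "z i \<le> r" "r < z (Suc i)" using cell_exists by blast
    have "z i \<noteq> r"
    proof (cases "i = 0")
      case True
      then show ?thesis using r ends by auto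
    next
      case False
      then have "z i \<in> {r \<in> D. W r = 0}" unfolding zeros using i by auto
      then show ?thesis using r by auto
    qed
    then show "r \<in> (\<Union>i<m. D \<inter> {z i<..<z (Suc i)})" using r i by force
  next
    fix r assume "r \<in> (\<Union>i<m. D \<inter> {z i<..<z (Suc i)})"
    then obtain i where i: "i < m" "r \<in> D" "z i < r" "r < z (Suc i)" by auto
    have "W r \<noteq> 0"
    proof
      assume "W r = 0"
      then have "r \<in> z ` {1..<m}" using zeros i by auto
      then obtain j where j: "r = z j" "j < m" by auto
      then have "\<not> j \<le> i" "\<not> Suc i \<le> j" using z_le[of j i] z_le[of "Suc i" j] i by auto
      then show False by simp
    qed
    then show "r \<in> {r \<in> D. W r \<noteq> 0}" using i by simp
  qed
  then show "components {r \<in> D. W r \<noteq> 0} = (\<lambda>i. D \<inter> {z i<..<z (Suc i)}) ` {..<m}"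
    using components_cells(1)[where z = z and m = m, OF T zl ne] by simp
  show "inj_on (\<lambda>i. D \<inter> {z i<..<z (Suc i)}) {..<m}"
    using components_cells(2)[where z = z and m = m, OF T zl ne] by simp
qed

context radial_domain
begin

lemma D_cases: "D = {a<..<R} \<or> D = {a..<R}" using shape by auto

lemma nodal_zones_alt: "nodal_zones \<Omega> W = components {r \<in> D. W r \<noteq> 0}"
  by (simp add: nodal_zones_def norm_image_domain)

lemma internal_zeros_alt: "internal_zeros \<Omega> W = {r \<in> D. W r = 0}"
  by (simp add: internal_zeros_def norm_image_domain)

lemma lists_zeros_card:
  assumes z: "lists_zeros a R D W m z"
  shows "card {r \<in> D. W r = 0} = m - 1"
proof -
  have "inj_on z {..m}" using z by (auto simp: lists_zeros_def intro: strict_mono_on_imp_inj_on)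
  then have "inj_on z {1..<m}" by (rule inj_on_subset) auto
  moreover have "{r \<in> D. W r = 0} = z ` {1..<m}" using z by (simp add: lists_zeros_def)
  ultimately show ?thesis by (simp add: card_image)
qed

lemma nodal_count_of_lists_zeros:
  assumes z: "lists_zeros a R D W m z"
  shows "nodal_count \<Omega> W m"
proof -
  have "{r \<in> D. W r = 0} = z ` {1..<m}" using z by (simp add: lists_zeros_def)
  then have "finite {r \<in> D. W r = 0}" by simp
  then show ?thesis
    using lists_zeros_components[OF z D_cases less] lists_zeros_card[OF z]
    by (simp add: nodal_count_def nodal_zones_alt internal_zeros_alt card_image)
qed

text \<open>The number of zones, and not only the number of zeros, is needed for a ball: if the origin were a zero,
the \<open>m - 1\<close> zeros would cut out only \<open>m - 1\<close> zones.\<close>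

lemma lists_zeros_of_nodal_count:
  assumes m: "2 \<le> m" and count: "nodal_count \<Omega> W m"
  shows "\<exists>z. lists_zeros a R D W m z"
proof -
  let ?Z = "{r \<in> D. W r = 0}"
  have fin: "finite ?Z" and card: "card ?Z = m - 1" and zones: "card (components {r \<in> D. W r \<noteq> 0}) = m"
    using count by (auto simp: nodal_count_def nodal_zones_alt internal_zeros_alt)
  have "W a \<noteq> 0" if aD: "a \<in> D"
  proof
    assume Wa: "W a = 0"
    let ?D = "{a<..<R}"
    have D: "D = insert a ?D" using shape aD less by auto
    have Z: "{r \<in> ?D. W r = 0} = ?Z - {a}" using D by auto
    have "card (?Z - {a}) = m - 2" using card aD Wa fin by simp
    then obtain z where z: "lists_zeros a R ?D W (Suc (m - 2)) z"
      using lists_zeros_exists[of ?D W a R] fin less unfolding Z by auto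
    have "{r \<in> ?D. W r \<noteq> 0} = {r \<in> D. W r \<noteq> 0}" using D Wa by auto
    then have "card (components {r \<in> D. W r \<noteq> 0}) = Suc (m - 2)"
      using lists_zeros_components[OF z _ less] by (simp add: card_image)
    then show False using zones m by simp
  qed
  then obtain z where "lists_zeros a R D W (Suc (card ?Z)) z"
    using lists_zeros_exists[OF fin less D_cases] by blast
  then show ?thesis using card m by auto
qed

lemma ordered_zones:
  assumes z: "lists_zeros a R D W m z"
  shows "ordered_nodal_zones \<Omega> W m (\<lambda>i. D \<inter> {z (i - 1)<..<z i})"
proof -
  let ?C = "\<lambda>i. D \<inter> {z i<..<z (Suc i)}"
  have "bij_betw ?C {..<m} (nodal_zones \<Omega> W)"
    using lists_zeros_components[OF z D_cases less] by (simp add: bij_betw_def nodal_zones_alt)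
  moreover have "bij_betw (\<lambda>i. i - 1) {1..m} {..<m}"
    by (rule bij_betw_byWitness[where f' = Suc]) auto
  ultimately have "bij_betw (?C \<circ> (\<lambda>i. i - 1)) {1..m} (nodal_zones \<Omega> W)"
    by (rule bij_betw_trans[rotated])
  then have "bij_betw (\<lambda>i. D \<inter> {z (i - 1)<..<z i}) {1..m} (nodal_zones \<Omega> W)"
    by (rule bij_betw_cong[THEN iffD1, rotated]) auto
  moreover have "r < s" if "i \<in> {1..m}" "j \<in> {1..m}" "i < j" "r < z i" "z (j - 1) < s" for i j r s
  proof -
    have "strict_mono_on {..m} z" using z by (simp add: lists_zeros_def)
    then have "z i \<le> z (j - 1)"
      using that(1-3) strict_mono_on_atMostD[of m z i "j - 1"] by (cases "i = j - 1") force+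
    then show ?thesis using that by simp
  qed
  ultimately show ?thesis unfolding ordered_nodal_zones_def by auto
qed

end

locale radial_pair = radial_domain \<Omega> a R D + radial_system a R D k U U' F V V' G
  for \<Omega> :: "'a::euclidean_space set" and a R :: real and D :: "real set" and k :: nat
    and U U' F V V' G :: "real \<Rightarrow> real"
begin

lemma flip_pair: "radial_pair \<Omega> a R D k V V' G U U' F"
  by (rule radial_pair.intro[OF radial_domain_axioms flip])

lemma critical_radius_iff:
  assumes z: "lists_zeros a R D U m z" and w: "lists_zeros a R D V m w"
  shows "critical_radius \<Omega> U r \<longleftrightarrow> r \<in> crit"
proof -
  have "r \<in> crit" if r: "r \<in> {a..R}" and zero: "(U has_real_derivative 0) (at r within {a..R})"
  proof -
    have "r \<in> D" using boundary_not_critical[OF z w, of r] r zero shape by fastforce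
    moreover have "at r within {a..R} \<noteq> bot"
      using r less by (auto simp: trivial_limit_within islimpt_Icc)
    ultimately show ?thesis using has_field_derivative_unique[OF deriv zero] by (intro critI) auto
  qed
  moreover have "r \<in> {a..R} \<and> (U has_real_derivative 0) (at r within {a..R})" if "r \<in> crit"
    using that deriv[of r] D_bounds[of r] by (auto simp: crit_def)
  ultimately show ?thesis unfolding critical_radius_def norm_image_closure by blast
qed

text \<open>The case of a single cell, in which the sign of \<open>U\<close> is prescribed by \<open>s\<close>.\<close>

lemma one_zone:
  assumes s: "\<And>r. r \<in> D \<Longrightarrow> 0 < s * U r"
  shows "\<forall>r\<in>D. 0 < s * V r" and "single_critical_point \<Omega> U" and "single_critical_point \<Omega> V"
proof -
  have none: "{r \<in> D. U r = 0} = {}" using s by force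
  have "\<exists>z. lists_zeros a R D U (Suc (card {r \<in> D. U r = 0})) z"
    by (rule lists_zeros_exists[OF _ less D_cases]) (use s in \<open>force simp: none\<close>)+
  then obtain z where z: "lists_zeros a R D U 1 z" unfolding none by auto
  obtain w where w: "lists_zeros a R D V 1 w" using other_lists_zeros[OF z] by blast
  interpret flip: radial_pair \<Omega> a R D k V V' G U U' F by (rule flip_pair)
  obtain \<sigma> :: "nat \<Rightarrow> real" where cells: "\<forall>i<1. (\<forall>x\<in>D. z i < x \<longrightarrow> x < z (Suc i) \<longrightarrow> 0 < \<sigma> i * U x) \<and>
    (\<forall>x\<in>D. w i < x \<longrightarrow> x < w (Suc i) \<longrightarrow> 0 < \<sigma> i * V x)"
    using common_signs[OF z w] by (elim exE) (rule that)
  have \<sigma>: "0 < \<sigma> 0 * U r" "0 < \<sigma> 0 * V r" if "r \<in> D" for r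
    using cells[rule_format, of 0] that z_facts(2)[OF z] z_facts(5)[OF z that]
      other.z_facts(2)[OF w] other.z_facts(5)[OF w that] D_bounds(2)[OF that] by simp_all
  show "\<forall>r\<in>D. 0 < s * V r"
  proof
    fix r assume r: "r \<in> D"
    show "0 < s * V r"
      using s[OF r] \<sigma>[OF r] by (auto simp: zero_less_mult_iff)
  qed
  have single: "single_critical_point \<Omega> W" if "\<And>r. critical_radius \<Omega> W r \<longleftrightarrow> r \<in> C" "C = c ` {..<1}" "C \<subseteq> D"
    "a \<in> D \<Longrightarrow> a \<in> C" for W :: "real \<Rightarrow> real" and C and c :: "nat \<Rightarrow> real"
  proof -
    have C: "C = {c 0}" using that(2) by auto
    have "c 0 \<in> norm ` \<Omega>" using that(3) C norm_image_domain by auto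
    moreover have "{r. critical_radius \<Omega> W r} = {c 0}" using that(1) C by auto
    moreover have "c 0 = 0" if "centered_ball \<Omega>"
      using centered_ball_imp[OF that] C \<open>a \<in> D \<Longrightarrow> a \<in> C\<close> by auto
    ultimately show ?thesis unfolding single_critical_point_def by blast
  qed
  obtain c :: "nat \<Rightarrow> real" where c: "crit = c ` {..<1}"
    using interlaced_critical[OF z w] by (elim exE conjE) (rule that, assumption)
  show "single_critical_point \<Omega> U"
    by (rule single[OF critical_radius_iff[OF z w] c crit_subset left_end_critical])
  obtain d :: "nat \<Rightarrow> real" where d: "other.crit = d ` {..<1}"
    using flip.interlaced_critical[OF w z] by (elim exE conjE) (rule that, assumption)
  show "single_critical_point \<Omega> V"
    by (rule single[OF flip.critical_radius_iff[OF w z] d other.crit_subset other.left_end_critical])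
qed

end

text \<open>The assertion about \<open>m\<close> nodal zones as a relation between \<open>U\<close> and \<open>V\<close>; it is symmetric, so it may be
derived from the number of zones of either function.\<close>

definition intertwined :: "'a::euclidean_space set \<Rightarrow> nat \<Rightarrow> (real \<Rightarrow> real) \<Rightarrow> (real \<Rightarrow> real) \<Rightarrow> bool" where
  "intertwined \<Omega> m U V \<longleftrightarrow>
    nodal_count \<Omega> U m \<and> nodal_count \<Omega> V m \<and>
    (\<exists>P Q. ordered_nodal_zones \<Omega> U m P \<and> ordered_nodal_zones \<Omega> V m Q \<and>
       (\<forall>i\<in>{1..m}.
          (\<forall>r\<in>P i. \<forall>s\<in>Q i. sgn (U r) = sgn (V s)) \<and>
          P i \<inter> Q i \<noteq> {} \<and>
          (\<exists>c d. {r \<in> P i. critical_radius \<Omega> U r} = {c} \<and>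
                 {s \<in> Q i. critical_radius \<Omega> V s} = {d} \<and>
                 c \<in> P i \<inter> Q i \<and> d \<in> P i \<inter> Q i)))"

lemma intertwined_sym:
  assumes "intertwined \<Omega> m U V"
  shows "intertwined \<Omega> m V U"
proof -
  obtain P Q where PQ: "ordered_nodal_zones \<Omega> U m P" "ordered_nodal_zones \<Omega> V m Q"
    "\<forall>i\<in>{1..m}. (\<forall>r\<in>P i. \<forall>s\<in>Q i. sgn (U r) = sgn (V s)) \<and> P i \<inter> Q i \<noteq> {} \<and>
      (\<exists>c d. {r \<in> P i. critical_radius \<Omega> U r} = {c} \<and> {s \<in> Q i. critical_radius \<Omega> V s} = {d} \<and>
        c \<in> P i \<inter> Q i \<and> d \<in> P i \<inter> Q i)"
    using assms unfolding intertwined_def by blast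
  have "(\<forall>r\<in>Q i. \<forall>s\<in>P i. sgn (V r) = sgn (U s)) \<and> Q i \<inter> P i \<noteq> {} \<and>
      (\<exists>c d. {r \<in> Q i. critical_radius \<Omega> V r} = {c} \<and> {s \<in> P i. critical_radius \<Omega> U s} = {d} \<and>
        c \<in> Q i \<inter> P i \<and> d \<in> Q i \<inter> P i)" if i: "i \<in> {1..m}" for i
  proof -
    note zones = PQ(3)[rule_format, OF i]
    then obtain c d where cd: "{r \<in> P i. critical_radius \<Omega> U r} = {c}"
      "{s \<in> Q i. critical_radius \<Omega> V s} = {d}" "c \<in> P i \<inter> Q i" "d \<in> P i \<inter> Q i"
      by (elim exE conjE) (rule that)
    have "\<forall>r\<in>Q i. \<forall>s\<in>P i. sgn (V r) = sgn (U s)" using zones by simp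
    then show ?thesis using zones cd unfolding Int_commute[of "Q i" "P i"]
      by (intro conjI exI[of _ d] exI[of _ c]) simp_all
  qed
  then have "\<forall>i\<in>{1..m}. (\<forall>r\<in>Q i. \<forall>s\<in>P i. sgn (V r) = sgn (U s)) \<and> Q i \<inter> P i \<noteq> {} \<and>
      (\<exists>c d. {r \<in> Q i. critical_radius \<Omega> V r} = {c} \<and> {s \<in> P i. critical_radius \<Omega> U s} = {d} \<and>
        c \<in> Q i \<inter> P i \<and> d \<in> Q i \<inter> P i)" by (rule ballI)
  moreover have "nodal_count \<Omega> V m" "nodal_count \<Omega> U m" using assms by (simp_all add: intertwined_def)
  ultimately show ?thesis unfolding intertwined_def
    using PQ(1,2) by (intro conjI exI[of _ Q] exI[of _ P])
qed

lemma (in radial_pair) zones_intertwined: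
  assumes m: "2 \<le> m" and count: "nodal_count \<Omega> U m"
  shows "intertwined \<Omega> m U V"
proof -
  interpret flip: radial_pair \<Omega> a R D k V V' G U U' F by (rule flip_pair)
  obtain z where z: "lists_zeros a R D U m z" using lists_zeros_of_nodal_count[OF m count] by blast
  obtain w where w: "lists_zeros a R D V m w" using other_lists_zeros[OF z] by blast
  define P where "P i = D \<inter> {z (i - 1)<..<z i}" for i
  define Q where "Q i = D \<inter> {w (i - 1)<..<w i}" for i
  obtain c where c: "crit = c ` {..<m}"
    "\<And>i. i < m \<Longrightarrow> z i < c i \<and> c i < z (Suc i) \<and> w i < c i \<and> c i < w (Suc i)"
    using interlaced_critical[OF z w] by (elim exE conjE) (rule that, assumption, simp)
  obtain d where d: "other.crit = d ` {..<m}"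
    "\<And>i. i < m \<Longrightarrow> w i < d i \<and> d i < w (Suc i) \<and> z i < d i \<and> d i < z (Suc i)"
    using flip.interlaced_critical[OF w z] by (elim exE conjE) (rule that, assumption, simp)
  obtain \<sigma> :: "nat \<Rightarrow> real" where \<sigma>: "\<forall>i<m. (\<forall>x\<in>D. z i < x \<longrightarrow> x < z (Suc i) \<longrightarrow> 0 < \<sigma> i * U x) \<and>
    (\<forall>x\<in>D. w i < x \<longrightarrow> x < w (Suc i) \<longrightarrow> 0 < \<sigma> i * V x)"
    using common_signs[OF z w] by (elim exE) (rule that)
  have "(\<forall>r\<in>P i. \<forall>s\<in>Q i. sgn (U r) = sgn (V s)) \<and> P i \<inter> Q i \<noteq> {} \<and>
      (\<exists>c d. {r \<in> P i. critical_radius \<Omega> U r} = {c} \<and> {s \<in> Q i. critical_radius \<Omega> V s} = {d} \<and>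
         c \<in> P i \<inter> Q i \<and> d \<in> P i \<inter> Q i)" if i: "i \<in> {1..m}" for i
  proof -
    define j where "j = i - 1"
    have j: "j < m" "i = Suc j" using i by (auto simp: j_def)
    have PQ: "P i = D \<inter> {z j<..<z (Suc j)}" "Q i = D \<inter> {w j<..<w (Suc j)}" using j by (auto simp: P_def Q_def)
    have "sgn (U r) = sgn (V s)" if "r \<in> P i" "s \<in> Q i" for r s
    proof -
      have "0 < \<sigma> j * U r" "0 < \<sigma> j * V s" using \<sigma>[rule_format, OF j(1)] that PQ by auto
      then show ?thesis by (auto simp: zero_less_mult_iff)
    qed
    moreover have cP: "c j \<in> P i \<inter> Q i" "d j \<in> P i \<inter> Q i"
      using c(2)[OF j(1)] d(2)[OF j(1)] c(1) d(1) j(1) PQ by (auto simp: crit_def other.crit_def)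
    moreover have "{r \<in> P i. critical_radius \<Omega> U r} = {c j}"
    proof -
      have "r = c j" if r: "r \<in> P i" "r \<in> crit" for r
      proof -
        obtain l where l: "l < m" "r = c l" using r(2) c(1) by auto
        then have "l = j" using r(1) c(2)[of l] j(1) unfolding PQ by (intro cell_unique[OF z, of l j r]) auto
        then show ?thesis using l by simp
      qed
      moreover have "c j \<in> crit" using c(1) j(1) by simp
      ultimately show ?thesis unfolding critical_radius_iff[OF z w] using cP(1) by blast
    qed
    moreover have "{r \<in> Q i. critical_radius \<Omega> V r} = {d j}"
    proof -
      have "r = d j" if r: "r \<in> Q i" "r \<in> other.crit" for r
      proof -
        obtain l where l: "l < m" "r = d l" using r(2) d(1) by auto
        then have "l = j" using r(1) d(2)[of l] j(1) unfolding PQ by (intro other.cell_unique[OF w, of l j r]) auto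
        then show ?thesis using l by simp
      qed
      moreover have "d j \<in> other.crit" using d(1) j(1) by simp
      ultimately show ?thesis unfolding flip.critical_radius_iff[OF w z] using cP(2) by blast
    qed
    ultimately show ?thesis by blast
  qed
  then show ?thesis
    unfolding intertwined_def
    using nodal_count_of_lists_zeros[OF w] count ordered_zones[OF z] ordered_zones[OF w]
    unfolding P_def[abs_def, symmetric] Q_def[abs_def, symmetric] by blast
qed

section \<open>The radial solutions of the Hamiltonian system\<close>

theorem proposition1p4:
  fixes \<Omega> :: "(real ^ 'n) set"
    and H :: "real \<Rightarrow> real \<times> real \<Rightarrow> real"
    and u v :: "real ^ 'n \<Rightarrow> real"
    and U V :: "real \<Rightarrow> real"
  assumes dim: "2 \<le> CARD('n)"
    and domain: "centered_ball \<Omega> \<or> spherical_shell \<Omega>"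
    and H_cont: "\<forall>p. continuous_on \<Omega> (\<lambda>x. H (norm x) p)"
    and H_C2: "\<forall>x\<in>\<Omega>. C2_on UNIV (H (norm x))"
    and H_sign: "AE x\<in>\<Omega> in lebesgue. \<forall>s t. s \<noteq> 0 \<and> t \<noteq> 0 \<longrightarrow>
                   H_u H (norm x) s t / s > 0 \<and> H_v H (norm x) s t / t > 0"
    and solution: "classical_solution \<Omega> H u v"
    and radial: "radial_profile \<Omega> u U" "radial_profile \<Omega> v V"
  shows
    "((\<forall>x\<in>\<Omega>. u x > 0) \<or> (\<forall>x\<in>\<Omega>. v x > 0) \<longrightarrow>
        (\<forall>x\<in>\<Omega>. u x > 0 \<and> v x > 0) \<and>
        single_critical_point \<Omega> U \<and> single_critical_point \<Omega> V) \<and>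
     ((\<forall>x\<in>\<Omega>. u x < 0) \<or> (\<forall>x\<in>\<Omega>. v x < 0) \<longrightarrow>
        (\<forall>x\<in>\<Omega>. u x < 0 \<and> v x < 0) \<and>
        single_critical_point \<Omega> U \<and> single_critical_point \<Omega> V) \<and>
     (\<forall>m\<ge>2. nodal_count \<Omega> U m \<or> nodal_count \<Omega> V m \<longrightarrow>
        nodal_count \<Omega> U m \<and> nodal_count \<Omega> V m \<and>
        (\<exists>P Q. ordered_nodal_zones \<Omega> U m P \<and> ordered_nodal_zones \<Omega> V m Q \<and>
           (\<forall>i\<in>{1..m}.
              (\<forall>r\<in>P i. \<forall>s\<in>Q i. sgn (U r) = sgn (V s)) \<and>
              P i \<inter> Q i \<noteq> {} \<and>
              (\<exists>c d. {r \<in> P i. critical_radius \<Omega> U r} = {c} \<and>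
                     {s \<in> Q i. critical_radius \<Omega> V s} = {d} \<and>
                     c \<in> P i \<inter> Q i \<and> d \<in> P i \<inter> Q i))))"
proof -
  obtain a R D where "radial_domain \<Omega> a R D" using radial_domain_exists[OF domain] by blast
  then interpret radial_domain \<Omega> a R D .
  obtain b :: "real ^ 'n" where b: "b \<in> Basis" using nonempty_Basis by blast
  interpret U: radial_function \<Omega> a R D u U b
    by unfold_locales (use b solution radial in \<open>auto simp: classical_solution_def\<close>)
  interpret V: radial_function \<Omega> a R D v V b
    by unfold_locales (use b solution radial in \<open>auto simp: classical_solution_def\<close>)
  define good where "good \<rho> \<longleftrightarrow>
    (\<forall>s t. s \<noteq> 0 \<and> t \<noteq> 0 \<longrightarrow> 0 < H_u H \<rho> s t / s \<and> 0 < H_v H \<rho> s t / t)" for \<rho>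
  have dense: "\<exists>r>x. r < y \<and> good r" if "a \<le> x" "x < y" "y \<le> R" for x y
    using H_sign that unfolding good_def[symmetric] by (rule good_radius)
  have ray: "r *\<^sub>R b \<in> \<Omega>" "norm (r *\<^sub>R b) = r" "u (r *\<^sub>R b) = U r" "v (r *\<^sub>R b) = V r" if "a < r" "r < R" for r
    using that U.on_ray[of r] D_iff_interior[of r] b a_nonneg U.profile_on_ray[of r] V.profile_on_ray[of r] by auto
  have continuous: "continuous_on UNIV (partial_deriv c (H r))" if "a < r" "r < R" "c \<in> Basis" for r c
    using partial_deriv_continuous[of "H r" c] H_C2 ray[OF that(1,2)] that(3) by fastforce
  have basis: "(1, 0) \<in> (Basis :: (real \<times> real) set)" "(0, 1) \<in> (Basis :: (real \<times> real) set)"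
    by (auto simp: Basis_prod_def)
  have H_v: "0 \<le> \<sigma> * H_v H r s t" if "good r" "a < r" "r < R" "0 \<le> \<sigma> * t" for r s t \<sigma>
    using sign_at_limit[of "partial_deriv (0, 1) (H r)" \<sigma> t s] continuous[of r "(0, 1)"] basis that
    by (auto simp: good_def H_v_def)
  have H_u: "0 \<le> \<sigma> * H_u H r s t" if "good r" "a < r" "r < R" "0 \<le> \<sigma> * s" for r s t \<sigma>
  proof -
    have "continuous_on UNIV (\<lambda>p. partial_deriv (1, 0) (H r) (prod.swap p))"
      by (rule continuous_on_compose2[OF continuous[OF that(2,3) basis(1)] continuous_on_swap]) simp
    from sign_at_limit[OF this, of \<sigma> s t] show ?thesis using that by (auto simp: good_def H_u_def)
  qed
  have sys_U: "flux_equation a R D (DIM(real ^ 'n) - 1) U U.U'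
      (\<lambda>r. r ^ (DIM(real ^ 'n) - 1) * H_v H r (U r) (V r)) V"
  proof (rule U.profile_flux_equation)
    show "- laplacian u (r *\<^sub>R b) = H_v H r (U r) (V r)" if "a < r" "r < R" for r
      using solution ray[OF that] by (auto simp: classical_solution_def)
    show "\<exists>r>x. r < y \<and> (\<forall>\<sigma>. 0 \<le> \<sigma> * V r \<longrightarrow> 0 \<le> \<sigma> * H_v H r (U r) (V r)) \<and>
        (U r \<noteq> 0 \<longrightarrow> V r \<noteq> 0 \<longrightarrow> H_v H r (U r) (V r) \<noteq> 0)" if xy: "a \<le> x" "x < y" "y \<le> R" for x y
    proof -
      obtain r where r: "x < r" "r < y" "good r" using dense[OF xy] by blast
      moreover have "H_v H r (U r) (V r) \<noteq> 0" if "U r \<noteq> 0" "V r \<noteq> 0"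
        using r(3) that unfolding good_def by fastforce
      ultimately show ?thesis using H_v[OF r(3)] xy by (intro exI[of _ r]) auto
    qed
  qed (use solution in \<open>simp add: classical_solution_def\<close>)
  have sys_V: "flux_equation a R D (DIM(real ^ 'n) - 1) V V.U'
      (\<lambda>r. r ^ (DIM(real ^ 'n) - 1) * H_u H r (U r) (V r)) U"
  proof (rule V.profile_flux_equation)
    show "- laplacian v (r *\<^sub>R b) = H_u H r (U r) (V r)" if "a < r" "r < R" for r
      using solution ray[OF that] by (auto simp: classical_solution_def)
    show "\<exists>r>x. r < y \<and> (\<forall>\<sigma>. 0 \<le> \<sigma> * U r \<longrightarrow> 0 \<le> \<sigma> * H_u H r (U r) (V r)) \<and>
        (V r \<noteq> 0 \<longrightarrow> U r \<noteq> 0 \<longrightarrow> H_u H r (U r) (V r) \<noteq> 0)" if xy: "a \<le> x" "x < y" "y \<le> R" for x y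
    proof -
      obtain r where r: "x < r" "r < y" "good r" using dense[OF xy] by blast
      moreover have "H_u H r (U r) (V r) \<noteq> 0" if "U r \<noteq> 0" "V r \<noteq> 0"
        using r(3) that unfolding good_def by fastforce
      ultimately show ?thesis using H_u[OF r(3)] xy by (intro exI[of _ r]) auto
    qed
  qed (use solution in \<open>simp add: classical_solution_def\<close>)
  interpret pair: radial_pair \<Omega> a R D "DIM(real ^ 'n) - 1"
    U U.U' "\<lambda>r. r ^ (DIM(real ^ 'n) - 1) * H_v H r (U r) (V r)"
    V V.U' "\<lambda>r. r ^ (DIM(real ^ 'n) - 1) * H_u H r (U r) (V r)"
    by (intro radial_pair.intro radial_system.intro radial_domain_axioms sys_U sys_V)
  interpret flip: radial_pair \<Omega> a R D "DIM(real ^ 'n) - 1"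
    V V.U' "\<lambda>r. r ^ (DIM(real ^ 'n) - 1) * H_u H r (U r) (V r)"
    U U.U' "\<lambda>r. r ^ (DIM(real ^ 'n) - 1) * H_v H r (U r) (V r)"
    by (rule pair.flip_pair)
  have range_u: "(\<forall>x\<in>\<Omega>. p (u x)) \<longleftrightarrow> (\<forall>r\<in>D. p (U r))" for p
    using U.u_radial' norm_image_domain by (metis (no_types, lifting) image_iff)
  have range_v: "(\<forall>x\<in>\<Omega>. p (v x)) \<longleftrightarrow> (\<forall>r\<in>D. p (V r))" for p
    using V.u_radial' norm_image_domain by (metis (no_types, lifting) image_iff)
  have positive: "(\<forall>x\<in>\<Omega>. u x > 0 \<and> v x > 0) \<and> single_critical_point \<Omega> U \<and> single_critical_point \<Omega> V"
    if "(\<forall>x\<in>\<Omega>. u x > 0) \<or> (\<forall>x\<in>\<Omega>. v x > 0)"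
    using that pair.one_zone[of 1] flip.one_zone[of 1]
    unfolding ball_conj_distrib range_u[of "\<lambda>t. t > 0"] range_v[of "\<lambda>t. t > 0"] by auto
  have negative: "(\<forall>x\<in>\<Omega>. u x < 0 \<and> v x < 0) \<and> single_critical_point \<Omega> U \<and> single_critical_point \<Omega> V"
    if "(\<forall>x\<in>\<Omega>. u x < 0) \<or> (\<forall>x\<in>\<Omega>. v x < 0)"
    using that pair.one_zone[of "- 1"] flip.one_zone[of "- 1"]
    unfolding ball_conj_distrib range_u[of "\<lambda>t. t < 0"] range_v[of "\<lambda>t. t < 0"] by auto
  have nodal: "intertwined \<Omega> m U V" if "2 \<le> m" "nodal_count \<Omega> U m \<or> nodal_count \<Omega> V m" for m
    using that pair.zones_intertwined flip.zones_intertwined intertwined_sym by blast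
  show ?thesis
    by (rule conjI, rule impI, erule positive, rule conjI, rule impI, erule negative,
        intro allI impI, erule nodal[unfolded intertwined_def], assumption)
qed

end
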